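(* Let $r\in\mathbb{N}$ and let $u_1,\ldots,u_r$ be disjoint non-commutator words. Then the word $\gamma_r(u_1,\ldots,u_r)$ is boundedly concise. In particular, $\gamma_r(x_1^{n_1},\ldots,x_r^{n_r})$ is boundedly concise for all $n_1,\ldots,n_r\in\mathbb{Z}\smallsetminus\{0\}$.
   Context: $\mathbb{N}$ denotes the positive integers. Words are elements of the free group $F$ of countable rank. For a word $w$ and a group $G$, $w\{G\}$ is the set of all values of $w$ in $G$ (obtained by substituting arbitrary elements of $G$ for the variables), and $w(G)=\langle w\{G\}\rangle$. A word $w$ is boundedly concise if there is a function $f_w:\mathbb{N}\to\mathbb{N}$ such that whenever $|w\{G\}|=m$ is finite for a group $G$, we have $|w(G)|\le f_w(m)$. Words are disjoint if the sets of variables that they involve are pairwise disjoint. A non-commutator word is a word lying outside $F'$; equivalently, the exponent sum of some variable in it is non-zero. Commutators are $[x,y]=x^{-1}y^{-1}xy$, and $\gamma_r(x_1,\ldots,x_r)=[x_1,\ldots,x_r]=[[x_1,\ldots,x_{r-1}],x_r]$, with $\gamma_1=x_1$; $\gamma_r(u_1,\ldots,u_r)$ is the word obtained by substituting $u_i$ for $x_i$. *)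

theory Defs
  imports "HOL-Algebra.Generated_Groups" "HOL-Library.Disjoint_Sets" "HOL-Library.Countable_Set"
begin

section \<open>The free group of countable rank\<close>

text \<open>
  The letter \<open>(i, True)\<close> is the variable $x_i$ and \<open>(i, False)\<close> is its inverse; elements of
  the free group are represented by their reduced forms.
\<close>

type_synonym word = "(nat \<times> bool) list"

definition cancels :: "nat \<times> bool \<Rightarrow> nat \<times> bool \<Rightarrow> bool" where
  "cancels a b \<longleftrightarrow> fst a = fst b \<and> snd a \<noteq> snd b"

definition reduced :: "word \<Rightarrow> bool" where
  "reduced w \<longleftrightarrow> successively (\<lambda>a b. \<not> cancels a b) w"

fun push :: "nat \<times> bool \<Rightarrow> word \<Rightarrow> word" where
  "push a [] = [a]"
| "push a (b # w) = (if cancels a b then w else a # b # w)"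

definition reduce :: "word \<Rightarrow> word" where
  "reduce w = foldr push w []"

definition free_group :: "word monoid"  (\<open>\<F>\<close>) where
  "\<F> = \<lparr>carrier = {w. reduced w}, monoid.mult = (\<lambda>u v. reduce (u @ v)), one = []\<rparr>"

abbreviation word_var :: "nat \<Rightarrow> word" where
  "word_var i \<equiv> [(i, True)]"

text \<open>The variables involved in a word are those occurring in its reduced form.\<close>

definition word_vars :: "word \<Rightarrow> nat set" where
  "word_vars w = fst ` set w"

definition non_commutator_word :: "word \<Rightarrow> bool" where
  "non_commutator_word w \<longleftrightarrow> w \<in> carrier \<F> \<and> w \<notin> derived \<F> (carrier \<F>)"


section \<open>Values of words and verbal subgroups\<close>

definition word_eval :: "('a, 'b) monoid_scheme \<Rightarrow> (nat \<Rightarrow> 'a) \<Rightarrow> word \<Rightarrow> 'a" where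
  "word_eval G \<rho> w =
     foldr (\<lambda>(i, s) g. (if s then \<rho> i else inv\<^bsub>G\<^esub> (\<rho> i)) \<otimes>\<^bsub>G\<^esub> g) w \<one>\<^bsub>G\<^esub>"

definition word_values :: "word \<Rightarrow> ('a, 'b) monoid_scheme \<Rightarrow> 'a set" where
  "word_values w G = {word_eval G \<rho> w | \<rho>. range \<rho> \<subseteq> carrier G}"

definition verbal_subgroup :: "word \<Rightarrow> ('a, 'b) monoid_scheme \<Rightarrow> 'a set" where
  "verbal_subgroup w G = generate G (word_values w G)"


section \<open>Commutator words\<close>

definition commutator :: "('a, 'b) monoid_scheme \<Rightarrow> 'a \<Rightarrow> 'a \<Rightarrow> 'a" where
  "commutator G x y = inv\<^bsub>G\<^esub> x \<otimes>\<^bsub>G\<^esub> inv\<^bsub>G\<^esub> y \<otimes>\<^bsub>G\<^esub> x \<otimes>\<^bsub>G\<^esub> y"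

text \<open>The variables of \<open>gamma_word r\<close> are $x_1, \ldots, x_r$; its value at \<open>r = 0\<close> is immaterial.\<close>

fun gamma_word :: "nat \<Rightarrow> word" where
  "gamma_word 0 = \<one>\<^bsub>\<F>\<^esub>"
| "gamma_word (Suc 0) = word_var 1"
| "gamma_word (Suc (Suc n)) = commutator \<F> (gamma_word (Suc n)) (word_var (Suc (Suc n)))"

text \<open>Substituting words for the variables of a word is evaluating it in the free group.\<close>

abbreviation subst_word :: "(nat \<Rightarrow> word) \<Rightarrow> word \<Rightarrow> word" where
  "subst_word u w \<equiv> word_eval \<F> u w"


section \<open>Bounded conciseness\<close>

definition conciseness_bound :: "'a itself \<Rightarrow> word \<Rightarrow> (nat \<Rightarrow> nat) \<Rightarrow> bool" where
  "conciseness_bound (_ :: 'a itself) w f \<longleftrightarrow>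
     (\<forall>G :: 'a monoid. group G \<and> finite (word_values w G) \<longrightarrow>
        finite (verbal_subgroup w G) \<and>
        card (verbal_subgroup w G) \<le> f (card (word_values w G)))"

text \<open>
  A word is boundedly concise if one function \<open>f\<close> is a bound for all groups. HOL cannot quantify
  over types inside a formula, and \<open>\<exists>f. conciseness_bound TYPE('a) w f\<close> would let \<open>f\<close> depend on
  the type \<open>'a\<close> of the group elements. Here \<open>f\<close> is therefore chosen before \<open>'a\<close> enters: a bound for
  the groups with elements of type \<open>nat\<close> exists, and every such function is also a bound for the
  groups with elements of type \<open>'a\<close>. To assert bounded conciseness is to assert this for
  arbitrary \<open>'a\<close>. The second conjunct always holds, by \<open>conciseness_bound_nat_imp\<close> below: a group
  with finitely many values of \<open>w\<close> has a countable subgroup in which \<open>w\<close> takes the same values.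
\<close>

definition boundedly_concise :: "'a itself \<Rightarrow> word \<Rightarrow> bool" where
  "boundedly_concise (_ :: 'a itself) w \<longleftrightarrow>
     (\<exists>f. conciseness_bound TYPE(nat) w f) \<and>
     (\<forall>f. conciseness_bound TYPE(nat) w f \<longrightarrow> conciseness_bound TYPE('a) w f)"


section \<open>The free group is a group\<close>

lemma reduced_push: "reduced w \<Longrightarrow> reduced (push a w)"
  by (cases w) (auto simp: reduced_def successively_Cons)

lemma push_cancel:
  assumes "reduced w" "cancels a b"
  shows "push a (push b w) = w"
proof (cases w)
  case Nil
  then show ?thesis using assms by simp
next
  case (Cons c v)
  show ?thesis
  proof (cases "cancels b c")
    case True
    then have "a = c" using assms(2) by (auto simp: cancels_def prod_eq_iff)
    then show ?thesis using Cons True assms(1)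
      by (cases v) (auto simp: reduced_def)
  qed (use Cons assms in auto)
qed

lemma reduced_foldr_push: "reduced v \<Longrightarrow> reduced (foldr push w v)"
  by (induction w) (auto simp: reduced_push)

lemma reduced_reduce: "reduced (reduce w)"
  unfolding reduce_def by (rule reduced_foldr_push) (simp add: reduced_def)

lemma foldr_push_push:
  assumes "reduced v"
  shows "foldr push (push a w) v = push a (foldr push w v)"
proof (cases w)
  case (Cons b w')
  then show ?thesis
    using push_cancel[OF reduced_foldr_push[OF assms]] by auto
qed simp

lemma foldr_push_foldr_push:
  "reduced v \<Longrightarrow> foldr push (foldr push w []) v = foldr push w v"
  by (induction w) (auto simp: foldr_push_push)

lemma reduce_append: "reduce (u @ v) = foldr push u (reduce v)"
  by (simp add: reduce_def)

lemma reduce_append_left: "reduce (reduce u @ v) = reduce (u @ v)"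
  by (simp add: reduce_append foldr_push_foldr_push reduced_reduce reduce_def[of u])

lemma reduce_reduced: "reduced w \<Longrightarrow> reduce w = w"
proof (induction w)
  case (Cons a w)
  then show ?case by (cases w) (auto simp: reduce_def reduced_def)
qed (simp add: reduce_def)

lemma reduce_append_right: "reduce (u @ reduce v) = reduce (u @ v)"
  by (simp add: reduce_append reduce_reduced reduced_reduce)

definition inverse_word :: "word \<Rightarrow> word" where
  "inverse_word w = rev (map (\<lambda>(i, s). (i, \<not> s)) w)"

lemma foldr_push_inverse_word: "reduced v \<Longrightarrow> foldr push (inverse_word w) (foldr push w v) = v"
proof (induction w)
  case (Cons a w)
  have "cancels (case a of (i, s) \<Rightarrow> (i, \<not> s)) a"
    by (auto simp: cancels_def split: prod.splits)
  with Cons show ?case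
    by (simp add: inverse_word_def push_cancel reduced_foldr_push)
qed (simp add: inverse_word_def)

lemma group_free_group: "group \<F>"
proof (rule groupI)
  fix x assume "x \<in> carrier \<F>"
  have "reduce (reduce (inverse_word x) @ x) = []"
    unfolding reduce_append_left
    by (simp add: reduce_def foldr_push_inverse_word reduced_def)
  then show "\<exists>y\<in>carrier \<F>. y \<otimes>\<^bsub>\<F>\<^esub> x = \<one>\<^bsub>\<F>\<^esub>"
    by (intro bexI[of _ "reduce (inverse_word x)"]) (auto simp: free_group_def reduced_reduce)
next
  show "\<one>\<^bsub>\<F>\<^esub> \<in> carrier \<F>" by (simp add: free_group_def reduced_def)
qed (auto simp: free_group_def reduced_reduce reduce_append_left reduce_append_right reduce_reduced)


section \<open>Bounds for groups on the natural numbers are bounds for all groups\<close>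

lemma (in group) word_eval_closed:
  "(\<And>i. \<rho> i \<in> carrier G) \<Longrightarrow> word_eval G \<rho> w \<in> carrier G"
  by (induction w) (auto simp: word_eval_def)

lemma (in group) word_eval_append:
  assumes "\<And>i. \<rho> i \<in> carrier G"
  shows "word_eval G \<rho> (u @ v) = word_eval G \<rho> u \<otimes> word_eval G \<rho> v"
proof (induction u)
  case Nil
  then show ?case using word_eval_closed[OF assms] by (simp add: word_eval_def)
next
  case (Cons a u)
  then show ?case
    using word_eval_closed[where \<rho> = \<rho> and w = u] word_eval_closed[where \<rho> = \<rho> and w = v] assms
    by (auto simp: word_eval_def m_assoc split: prod.splits)
qed

lemma (in group) word_eval_inverse_word:
  assumes "\<And>i. \<rho> i \<in> carrier G"
  shows "word_eval G \<rho> (inverse_word w) = inv (word_eval G \<rho> w)"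
proof (induction w)
  case Nil
  then show ?case by (simp add: word_eval_def inverse_word_def)
next
  case (Cons a w)
  have "word_eval G \<rho> (inverse_word (a # w)) =
      word_eval G \<rho> (inverse_word w) \<otimes> word_eval G \<rho> (inverse_word [a])"
    using word_eval_append[where \<rho> = \<rho> and u = "inverse_word w" and v = "inverse_word [a]"] assms
    by (simp add: inverse_word_def)
  moreover have "word_eval G \<rho> (inverse_word [a]) = inv (word_eval G \<rho> [a])"
    using assms by (auto simp: inverse_word_def word_eval_def split: prod.splits)
  moreover have "word_eval G \<rho> (a # w) = word_eval G \<rho> [a] \<otimes> word_eval G \<rho> w"
    using word_eval_append[where \<rho> = \<rho> and u = "[a]" and v = w] assms by simp
  ultimately show ?case
    using Cons word_eval_closed[OF assms] by (simp add: inv_mult_group)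
qed

lemma (in group) subgroup_range_word_eval:
  assumes "\<And>i. \<rho> i \<in> carrier G"
  shows "subgroup (range (word_eval G \<rho>)) G"
proof (rule subgroupI)
  fix a assume "a \<in> range (word_eval G \<rho>)"
  then obtain u where "a = word_eval G \<rho> u" by blast
  then have "inv a = word_eval G \<rho> (inverse_word u)"
    by (simp add: word_eval_inverse_word assms)
  then show "inv a \<in> range (word_eval G \<rho>)" by blast
next
  fix a b assume "a \<in> range (word_eval G \<rho>)" "b \<in> range (word_eval G \<rho>)"
  then obtain u v where "a = word_eval G \<rho> u" "b = word_eval G \<rho> v" by blast
  then have "a \<otimes> b = word_eval G \<rho> (u @ v)"
    by (simp add: word_eval_append assms)
  then show "a \<otimes> b \<in> range (word_eval G \<rho>)" by blast
qed (auto simp: word_eval_closed assms)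

lemma (in group_hom) hom_word_eval:
  assumes "\<And>i. \<rho> i \<in> carrier G"
  shows "h (word_eval G \<rho> w) = word_eval H (h \<circ> \<rho>) w"
proof (induction w)
  case (Cons a w)
  then show ?case
    using assms G.word_eval_closed[where \<rho> = \<rho> and w = w]
    by (auto simp: word_eval_def split: prod.splits)
qed (simp add: word_eval_def)

lemma (in group) countable_subgroup_nat_copy:
  assumes "subgroup K G" "countable K"
  obtains N :: "nat monoid" and h where "group_hom N G h" "inj_on h (carrier N)" "h ` carrier N = K"
proof -
  let ?K = "G\<lparr>carrier := K\<rparr>"
  let ?t = "to_nat_on K"
  let ?h = "inv_into K ?t"
  define N where "N = \<lparr>carrier = ?t ` K, monoid.mult = (\<lambda>x y. ?t (?h x \<otimes> ?h y)), one = ?t \<one>\<rparr>"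
  interpret K: subgroup K G by fact
  have inj: "inj_on ?t K" using assms(2) by (rule inj_on_to_nat_on)
  have ht [simp]: "?h (?t x) = x" if "x \<in> K" for x using inj that by simp
  have "group N"
  proof (rule groupI)
    fix x assume "x \<in> carrier N"
    then obtain a where a: "a \<in> K" "x = ?t a" by (auto simp: N_def)
    then show "\<exists>y\<in>carrier N. y \<otimes>\<^bsub>N\<^esub> x = \<one>\<^bsub>N\<^esub>"
      by (intro bexI[of _ "?t (inv a)"]) (auto simp: N_def)
  qed (auto simp: N_def m_assoc)
  moreover have "?h \<in> hom N G"
    by (rule homI) (auto simp: N_def)
  ultimately have "group_hom N G ?h"
    using is_group by (simp add: group_hom_def group_hom_axioms_def)
  moreover have "inj_on ?h (carrier N)" "?h ` carrier N = K"
    using inj by (auto simp: N_def inj_on_inv_into image_image)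
  ultimately show ?thesis using that by blast
qed

lemma conciseness_bound_nat_imp:
  assumes nat: "conciseness_bound TYPE(nat) w f"
  shows "conciseness_bound TYPE('a) w f"
  unfolding conciseness_bound_def
proof (intro allI impI)
  fix G :: "'a monoid"
  assume G: "group G \<and> finite (word_values w G)"
  then interpret group G by simp
  let ?V = "word_values w G"
  have "\<forall>v\<in>?V. \<exists>\<rho>. range \<rho> \<subseteq> carrier G \<and> v = word_eval G \<rho> w"
    by (auto simp: word_values_def)
  then obtain \<rho> where \<rho>: "\<And>v. v \<in> ?V \<Longrightarrow> range (\<rho> v) \<subseteq> carrier G \<and> v = word_eval G (\<rho> v) w"
    by metis
  let ?S = "insert \<one>\<^bsub>G\<^esub> (\<Union>v\<in>?V. range (\<rho> v))"
  have "countable ?S" using G by (simp add: countable_finite)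
  define e where "e = from_nat_into ?S"
  have re: "range e = ?S"
    unfolding e_def by (rule range_from_nat_into) (use \<open>countable ?S\<close> in auto)
  then have e: "e i \<in> carrier G" for i using \<rho> rangeI[of e i] by auto
  let ?K = "range (word_eval G e)"
  have SK: "?S \<subseteq> ?K"
  proof
    fix x assume "x \<in> ?S"
    then obtain i where "x = e i" using re by (metis rangeE)
    then have "x = word_eval G e (word_var i)" using e by (simp add: word_eval_def)
    then show "x \<in> ?K" by blast
  qed
  have subK: "subgroup ?K G" by (rule subgroup_range_word_eval) (rule e)
  obtain N :: "nat monoid" and h where N: "group_hom N G h" "inj_on h (carrier N)" "h ` carrier N = ?K"
    by (rule countable_subgroup_nat_copy[OF subK countable_image[OF countableI_type]])
  interpret h: group_hom N G h by fact
  have V: "?V = h ` word_values w N"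
  proof (intro equalityI subsetI)
    fix v assume v: "v \<in> ?V"
    have "\<rho> v i \<in> ?S" for i using v by blast
    then have "\<rho> v i \<in> h ` carrier N" for i using SK unfolding N(3) by (rule subsetD[rotated])
    then have "\<forall>i. \<exists>x. x \<in> carrier N \<and> \<rho> v i = h x" by blast
    then obtain \<sigma> where \<sigma>: "\<And>i. \<sigma> i \<in> carrier N" "\<And>i. \<rho> v i = h (\<sigma> i)"
      by metis
    have "\<rho> v = h \<circ> \<sigma>" using \<sigma>(2) by auto
    then have "v = h (word_eval N \<sigma> w)"
      using \<rho>[OF v] h.hom_word_eval[where \<rho> = \<sigma> and w = w] \<sigma>(1) by simp
    moreover have "range \<sigma> \<subseteq> carrier N" using \<sigma> by auto
    ultimately show "v \<in> h ` word_values w N" by (auto simp: word_values_def)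
  next
    fix v assume "v \<in> h ` word_values w N"
    then obtain \<sigma> where \<sigma>: "range \<sigma> \<subseteq> carrier N" "v = h (word_eval N \<sigma> w)"
      by (auto simp: word_values_def)
    then have "v = word_eval G (h \<circ> \<sigma>) w" using h.hom_word_eval[where \<rho> = \<sigma> and w = w] by auto
    moreover have "range (h \<circ> \<sigma>) \<subseteq> carrier G" using \<sigma> by auto
    ultimately show "v \<in> ?V" unfolding word_values_def by blast
  qed
  have VN: "word_values w N \<subseteq> carrier N"
    by (auto simp: word_values_def intro!: h.G.word_eval_closed)
  have inj: "inj_on h (word_values w N)" using N(2) VN by (rule inj_on_subset)
  have gen: "verbal_subgroup w G = h ` verbal_subgroup w N"
    unfolding verbal_subgroup_def V using h.generate_img[OF VN] by simp
  have "finite (word_values w N)" using G V inj by (simp add: finite_image_iff)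
  then have "finite (verbal_subgroup w N)"
    "card (verbal_subgroup w N) \<le> f (card (word_values w N))"
    using nat h.G.is_group by (auto simp: conciseness_bound_def)
  moreover have "inj_on h (verbal_subgroup w N)"
    using N(2) h.G.generate_incl[OF VN] by (auto simp: verbal_subgroup_def intro: inj_on_subset)
  ultimately show "finite (verbal_subgroup w G) \<and> card (verbal_subgroup w G) \<le> f (card ?V)"
    using gen V inj by (simp add: card_image)
qed

end

theory Submission
  imports Defs
begin

text \<open>
  Write \<open>W = {[y,x] | y \<in> Y, x \<in> X}\<close> where \<open>Y\<close> is the set of values of
  \<open>\<gamma>\<^sub>r\<^sub>-\<^sub>1(u\<^sub>1, \<dots>, u\<^sub>r\<^sub>-\<^sub>1)\<close> and \<open>X\<close> is the set of values of \<open>u\<^sub>r\<close>. Both are invariant under conjugation and, as \<open>u\<^sub>r\<close> is a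
  non-commutator word, \<open>X\<close> contains all \<open>k\<close>-th powers for some \<open>k > 0\<close>. If \<open>|W| \<le> m\<close>, then by
  Dietzmann's lemma it suffices to bound the orders of the elements of \<open>W\<close>, which is done by
  induction on \<open>r\<close>.

  Let \<open>V\<close> be generated by \<open>W\<close>. As \<open>V\<close> acts on \<open>W\<close> by conjugation, its derived subgroup is finite of
  bounded order, so we may assume that \<open>V\<close> is abelian. Let \<open>q = k m!\<close>, let \<open>E\<close> be the \<open>q\<close>-torsion of
  \<open>V\<close>, and let \<open>D = {g. [g,x] \<in> E for all x \<in> X}\<close>, a normal subgroup. If \<open>x\<close> and \<open>x'\<close> act in the
  same way on \<open>W\<close>, then \<open>c = x x'\<^sup>-\<^sup>1\<close> centralizes \<open>V\<close>, the powers \<open>[y,c]\<^sup>k\<^sup>i = [y,c\<^sup>k\<^sup>i]\<close> lie in \<open>W\<close>,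
  and hence \<open>[y,c] \<in> E\<close>. So modulo \<open>E\<close> the map \<open>x \<mapsto> [y,x]\<close> takes boundedly many arguments, \<open>Y\<close> has
  boundedly many elements modulo \<open>D\<close>, and by induction \<open>y\<^sup>N \<in> D\<close> for a bounded \<open>N\<close>. On the other hand
  \<open>v = [y,x]\<close> satisfies \<open>v\<^sup>q = [u,x]\<close> for some \<open>u \<in> V\<close>, because \<open>x\<^sup>q\<close> commutes with \<open>y\<close>. Replacing \<open>x\<close> by
  its conjugates under powers of \<open>u\<close> shows that \<open>v\<^sup>p\<close> commutes with \<open>y\<close> for \<open>p = q m!\<close>. Therefore
  \<open>v\<^sup>p\<^sup>N = [y\<^sup>N,x]\<^sup>p\<close>, and the \<open>q\<close>-th power of this is trivial.
\<close>

section \<open>Powers and pigeonhole\<close>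

text \<open>Two of the m + 1 indices \<open>0..m\<close> must collide, and their distance is at most
  \<open>m\<close>, hence divides \<open>fact m\<close>. The factorial is a multiple of every such
  distance, which keeps later exponents independent of the element at hand.\<close>

lemma pigeonhole_period:
  fixes f :: "nat \<Rightarrow> 'b"
  assumes "finite T" "card T \<le> m" "\<And>i. f i \<in> T"
  obtains d i where "0 < d" "d dvd fact m" "f i = f (i + d)"
proof -
  have "\<not> inj_on f {0..m}"
  proof
    assume "inj_on f {0..m}"
    moreover have "f ` {0..m} \<subseteq> T" using assms(3) by auto
    ultimately have "card {0..m} \<le> card T" using assms(1) by (meson card_inj_on_le)
    then show False using assms(2) by simp
  qed
  then obtain i j where ij: "i \<le> m" "j \<le> m" "i < j" "f i = f j"
    unfolding inj_on_def by (metis atLeastAtMost_iff linorder_neqE_nat)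
  then have "(j - i) dvd (fact m :: nat)" by (intro dvd_fact) auto
  then show ?thesis using that[of "j - i" i] ij by simp
qed

context group
begin

lemma inv_mult_cancel [simp]:
  "x \<in> carrier G \<Longrightarrow> y \<in> carrier G \<Longrightarrow> inv x \<otimes> (x \<otimes> y) = y"
  "x \<in> carrier G \<Longrightarrow> y \<in> carrier G \<Longrightarrow> x \<otimes> (inv x \<otimes> y) = y"
  by (simp_all add: m_assoc[symmetric])

lemma pow_eq_one_dvd:
  assumes "a \<in> carrier G" "a [^] (d :: nat) = \<one>" "d dvd n"
  shows "a [^] n = \<one>"
proof -
  obtain c where "n = d * c" using assms(3) by (elim dvdE)
  then show ?thesis using assms(1,2) by (simp add: nat_pow_pow[symmetric])
qed

text \<open>A collision \<open>a^i c = a^(i+d) c\<close> gives \<open>a^d = 1\<close>. The factor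
  \<open>c\<close> is there for \<open>commute_commutator_pow\<close>, where it is the multiples of
  one fixed commutator that are known to stay in \<open>W\<close>.\<close>

lemma pow_fact_eq_one:
  assumes "finite T" "card T \<le> m" "a \<in> carrier G" "c \<in> carrier G"
    and "\<And>i :: nat. a [^] i \<otimes> c \<in> T"
  shows "a [^] (fact m :: nat) = \<one>"
proof -
  obtain d i :: nat where "0 < d" and d: "d dvd fact m" "a [^] i \<otimes> c = a [^] (i + d) \<otimes> c"
    by (rule pigeonhole_period[where f = "\<lambda>i. a [^] i \<otimes> c", OF assms(1,2,5)])
  from d(2) have "a [^] (i + d) = a [^] i" using assms(3,4) by simp
  then have "a [^] i \<otimes> a [^] d = a [^] i" using assms(3) by (simp add: nat_pow_mult)
  then have "a [^] d = \<one>" using assms(3) by simp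
  with assms(3) show ?thesis using d(1) by (rule pow_eq_one_dvd)
qed

lemma conj_pow:
  assumes "x \<in> carrier G" "g \<in> carrier G"
  shows "inv g \<otimes> x [^] (n :: nat) \<otimes> g = (inv g \<otimes> x \<otimes> g) [^] n"
proof (induction n)
  case (Suc n)
  have "inv g \<otimes> x [^] Suc n \<otimes> g = (inv g \<otimes> x [^] n \<otimes> g) \<otimes> (inv g \<otimes> x \<otimes> g)"
    using assms by (simp add: m_assoc)
  then show ?case using Suc by simp
qed (use assms in simp)

lemma commute_pow:
  assumes "x \<in> carrier G" "y \<in> carrier G" "x \<otimes> y = y \<otimes> x"
  shows "x [^] (n :: nat) \<otimes> y = y \<otimes> x [^] n"
  using group_commutes_pow[OF assms(3,1,2)] .


section \<open>Commutator identities\<close>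

lemma commutator_closed [simp]:
  "x \<in> carrier G \<Longrightarrow> y \<in> carrier G \<Longrightarrow> commutator G x y \<in> carrier G"
  by (simp add: commutator_def)

lemma commutator_conj:
  "x \<in> carrier G \<Longrightarrow> y \<in> carrier G \<Longrightarrow> g \<in> carrier G \<Longrightarrow>
    inv g \<otimes> commutator G x y \<otimes> g = commutator G (inv g \<otimes> x \<otimes> g) (inv g \<otimes> y \<otimes> g)"
  by (simp add: commutator_def m_assoc inv_mult_group)

lemma commutator_mult_right:
  "y \<in> carrier G \<Longrightarrow> a \<in> carrier G \<Longrightarrow> b \<in> carrier G \<Longrightarrow>
    commutator G y (a \<otimes> b) = commutator G y b \<otimes> (inv b \<otimes> commutator G y a \<otimes> b)"
  by (simp add: commutator_def m_assoc inv_mult_group)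

lemma commutator_mult_left:
  "x \<in> carrier G \<Longrightarrow> a \<in> carrier G \<Longrightarrow> b \<in> carrier G \<Longrightarrow>
    commutator G (a \<otimes> b) x = (inv b \<otimes> commutator G a x \<otimes> b) \<otimes> commutator G b x"
  by (simp add: commutator_def m_assoc inv_mult_group)

lemma commutator_inv_right:
  "y \<in> carrier G \<Longrightarrow> a \<in> carrier G \<Longrightarrow>
    commutator G y (inv a) = inv (a \<otimes> commutator G y a \<otimes> inv a)"
  by (simp add: commutator_def m_assoc inv_mult_group)

lemma commutator_eq_one_iff:
  assumes "x \<in> carrier G" "y \<in> carrier G"
  shows "commutator G x y = \<one> \<longleftrightarrow> x \<otimes> y = y \<otimes> x"
proof -
  have "x \<otimes> y = y \<otimes> x \<otimes> commutator G x y"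
    using assms by (simp add: commutator_def m_assoc)
  then show ?thesis using assms by simp
qed

lemma commutator_one_right [simp]: "x \<in> carrier G \<Longrightarrow> commutator G x \<one> = \<one>"
  by (simp add: commutator_def)

text \<open>If \<open>[a,b]\<^sup>n\<close> commutes with \<open>b\<close>, then \<open>[a,b]\<^sup>n\<^sup>+\<^sup>1\<close> is a product of \<open>n\<close> commutators, which is
  one factor fewer.\<close>

lemma commutator_pow_Suc:
  assumes "a \<in> carrier G" "b \<in> carrier G" "0 < n"
    and "commutator G a b [^] n \<otimes> b = b \<otimes> commutator G a b [^] n"
  shows "commutator G a b [^] Suc n =
    commutator G a (b \<otimes> b) \<otimes> commutator G (inv b \<otimes> a \<otimes> b) b [^] (n - 1)"
proof -
  let ?c = "commutator G a b"
  obtain k where k: "n = Suc k" using assms(3) by (cases n) auto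
  have "?c [^] Suc n = ?c \<otimes> ?c [^] n" using assms by (intro nat_pow_Suc2) simp
  also have "\<dots> = inv a \<otimes> inv b \<otimes> a \<otimes> (b \<otimes> ?c [^] n)"
    using assms by (simp add: commutator_def[of G a b] m_assoc)
  also have "b \<otimes> ?c [^] n = ?c [^] n \<otimes> b" using assms(4) by simp
  also have "?c [^] n = ?c \<otimes> ?c [^] k"
    unfolding k using assms by (intro nat_pow_Suc2) simp
  also have "inv a \<otimes> inv b \<otimes> a \<otimes> (?c \<otimes> ?c [^] k \<otimes> b) =
      inv a \<otimes> inv b \<otimes> a \<otimes> ?c \<otimes> b \<otimes> (inv b \<otimes> ?c [^] k \<otimes> b)"
    using assms by (simp add: m_assoc)
  also have "inv b \<otimes> ?c [^] k \<otimes> b = commutator G (inv b \<otimes> a \<otimes> b) b [^] k"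
    using assms by (simp add: conj_pow commutator_conj)
  also have "inv a \<otimes> inv b \<otimes> a \<otimes> ?c \<otimes> b = commutator G a (b \<otimes> b)"
    using assms by (simp add: commutator_def m_assoc inv_mult_group)
  finally show ?thesis using k by simp
qed

end

section \<open>Bounding subgroups by shortening products\<close>

definition conj_invariant :: "('a, 'b) monoid_scheme \<Rightarrow> 'a set \<Rightarrow> bool" where
  "conj_invariant G S \<longleftrightarrow>
     S \<subseteq> carrier G \<and> (\<forall>s\<in>S. \<forall>g\<in>carrier G. inv\<^bsub>G\<^esub> g \<otimes>\<^bsub>G\<^esub> s \<otimes>\<^bsub>G\<^esub> g \<in> S)"

context group
begin

definition list_product :: "'a list \<Rightarrow> 'a" where
  "list_product xs = foldr (\<otimes>) xs \<one>"

lemma list_product_simps [simp]: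
  "list_product [] = \<one>"
  "list_product (x # xs) = x \<otimes> list_product xs"
  by (simp_all add: list_product_def)

lemma list_product_closed [simp]: "set xs \<subseteq> carrier G \<Longrightarrow> list_product xs \<in> carrier G"
  by (induction xs) auto

lemma list_product_append:
  "set xs \<subseteq> carrier G \<Longrightarrow> set ys \<subseteq> carrier G \<Longrightarrow>
    list_product (xs @ ys) = list_product xs \<otimes> list_product ys"
  by (induction xs) (auto simp: m_assoc)

lemma list_product_replicate:
  "x \<in> carrier G \<Longrightarrow> list_product (replicate n x) = x [^] n"
proof (induction n)
  case (Suc n)
  then show ?case using nat_pow_Suc2[of x n] by simp
qed simp

text \<open>The copies of \<open>a\<close> move to the front by
  \<open>x a^N = a^N (a^(-N) x a^N)\<close>. The conjugated entry remains in \<open>S\<close>, since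
  closure under conjugation by \<open>a\<close> extends to conjugation by its powers.\<close>

lemma list_product_extract_power:
  assumes "S \<subseteq> carrier G" "\<And>x y. x \<in> S \<Longrightarrow> y \<in> S \<Longrightarrow> inv y \<otimes> x \<otimes> y \<in> S" "a \<in> S"
    and "set xs \<subseteq> S" "N \<le> count_list xs a"
  shows "\<exists>ys. set ys \<subseteq> S \<and> length ys + N = length xs \<and> list_product xs = a [^] N \<otimes> list_product ys"
  using assms(4,5)
proof (induction xs arbitrary: N)
  case (Cons x xs)
  have a: "a \<in> carrier G" and x: "x \<in> S" "x \<in> carrier G" using assms(1,3) Cons.prems(1) by auto
  show ?case
  proof (cases N)
    case 0
    then show ?thesis using Cons.prems(1) assms(1)
      by (intro exI[of _ "x # xs"]) (auto simp: subset_iff)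
  next
    case (Suc N')
    show ?thesis
    proof (cases "x = a")
      case True
      then obtain ys where ys: "set ys \<subseteq> S" "length ys + N' = length xs"
          "list_product xs = a [^] N' \<otimes> list_product ys"
        using Cons.IH[of N'] Cons.prems Suc by auto
      have "list_product ys \<in> carrier G" using ys(1) assms(1) by simp
      then have "list_product (x # xs) = a [^] N \<otimes> list_product ys"
        using ys a Suc True by (simp add: m_assoc[symmetric] nat_pow_Suc2[symmetric] del: nat_pow_Suc)
      then show ?thesis using ys Suc by (intro exI[of _ ys]) auto
    next
      case False
      then obtain ys where ys: "set ys \<subseteq> S" "length ys + N = length xs"
          "list_product xs = a [^] N \<otimes> list_product ys"
        using Cons.IH[of N] Cons.prems Suc by auto
      let ?x = "inv (a [^] N) \<otimes> x \<otimes> a [^] N"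
      have "inv (a [^] k) \<otimes> x \<otimes> a [^] k \<in> S" for k :: nat
      proof (induction k)
        case (Suc k)
        have "inv (a [^] Suc k) \<otimes> x \<otimes> a [^] Suc k = inv a \<otimes> (inv (a [^] k) \<otimes> x \<otimes> a [^] k) \<otimes> a"
          using a x by (simp add: m_assoc inv_mult_group)
        then show ?case using assms(2)[OF Suc assms(3)] by simp
      qed (use x in simp)
      moreover have "list_product ys \<in> carrier G" using ys(1) assms(1) by simp
      then have "list_product (x # xs) = a [^] N \<otimes> list_product (?x # ys)"
        using ys(3) a x by (simp add: m_assoc)
      ultimately show ?thesis using ys by (intro exI[of _ "?x # ys"]) auto
    qed
  qed
qed auto

text \<open>A product of more than \<open>card S * N\<close> factors contains some \<open>a\<close>
  at least \<open>N\<close> times. The power \<open>a^N\<close> is brought to the front and replaced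
  by fewer than \<open>N\<close> factors, so induction on the length applies.\<close>

lemma list_product_shorten:
  assumes "S \<subseteq> carrier G" "finite S" "\<And>x y. x \<in> S \<Longrightarrow> y \<in> S \<Longrightarrow> inv y \<otimes> x \<otimes> y \<in> S"
    and pow: "\<And>x. x \<in> S \<Longrightarrow> \<exists>zs. set zs \<subseteq> S \<and> length zs < N \<and> list_product zs = x [^] N"
    and "set xs \<subseteq> S"
  shows "\<exists>ys. set ys \<subseteq> S \<and> length ys \<le> card S * N \<and> list_product xs = list_product ys"
  using assms(5)
proof (induction xs rule: length_induct)
  case (1 xs)
  show ?case
  proof (cases "length xs \<le> card S * N")
    case False
    have "\<exists>a\<in>S. N \<le> count_list xs a"
    proof (rule ccontr)
      assume "\<not> (\<exists>a\<in>S. N \<le> count_list xs a)"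
      then have "sum (count_list xs) S \<le> (\<Sum>a\<in>S. N)" by (intro sum_mono) (auto simp: not_le less_imp_le)
      then show False using sum_count_set[OF 1(2) assms(2)] False by simp
    qed
    then obtain a where a: "a \<in> S" "N \<le> count_list xs a" by blast
    obtain ys where ys: "set ys \<subseteq> S" "length ys + N = length xs"
        "list_product xs = a [^] N \<otimes> list_product ys"
      using list_product_extract_power[OF assms(1,3) a(1) 1(2) a(2)] by blast
    obtain zs where zs: "set zs \<subseteq> S" "length zs < N" "list_product zs = a [^] N"
      using pow[OF a(1)] by blast
    have "list_product xs = list_product (zs @ ys)"
      using ys zs assms(1) by (subst list_product_append) auto
    moreover have "length (zs @ ys) < length xs" "set (zs @ ys) \<subseteq> S" using ys zs by auto
    ultimately show ?thesis using 1(1) by metis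
  qed (use 1 in blast)
qed

lemma generate_subset_list_products:
  assumes "S \<subseteq> carrier G" "\<And>x. x \<in> S \<Longrightarrow> \<exists>zs. set zs \<subseteq> S \<and> list_product zs = inv x"
  shows "generate G S \<subseteq> list_product ` {xs. set xs \<subseteq> S}"
proof
  fix g assume "g \<in> generate G S"
  then show "g \<in> list_product ` {xs. set xs \<subseteq> S}"
  proof (induction rule: generate.induct)
    case one
    then show ?case by (intro image_eqI[of _ _ "[]"]) auto
  next
    case (incl h)
    then show ?case using assms(1) by (intro image_eqI[of _ _ "[h]"]) auto
  next
    case (inv h)
    then show ?case using assms(2)[of h] by force
  next
    case (eng h1 h2)
    then obtain xs ys where "set xs \<subseteq> S" "h1 = list_product xs" "set ys \<subseteq> S" "h2 = list_product ys"
      by auto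
    then show ?case using assms(1)
      by (intro image_eqI[of _ _ "xs @ ys"]) (simp_all add: list_product_append)
  qed
qed

text \<open>The bound counts the lists of length at most \<open>s * N\<close> over \<open>s\<close>
  letters. Dietzmann's lemma assumes \<open>x^N = 1\<close>; here it is enough that
  \<open>x^N\<close> is a shorter product, which is what
  \<open>derived_generate_finite_bound\<close> can supply for commutators.\<close>

lemma generate_finite_bound:
  assumes "S \<subseteq> carrier G" "finite S" "card S \<le> s" "\<And>x y. x \<in> S \<Longrightarrow> y \<in> S \<Longrightarrow> inv y \<otimes> x \<otimes> y \<in> S"
    and "\<And>x. x \<in> S \<Longrightarrow> \<exists>zs. set zs \<subseteq> S \<and> length zs < N \<and> list_product zs = x [^] N"
    and "\<And>x. x \<in> S \<Longrightarrow> \<exists>zs. set zs \<subseteq> S \<and> list_product zs = inv x"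
  shows "finite (generate G S) \<and> card (generate G S) \<le> (\<Sum>i\<le>s * N. s ^ i)"
proof -
  let ?L = "{xs. set xs \<subseteq> S \<and> length xs \<le> card S * N}"
  have sub: "generate G S \<subseteq> list_product ` ?L"
  proof
    fix g assume "g \<in> generate G S"
    then obtain xs where "set xs \<subseteq> S" "g = list_product xs"
      using generate_subset_list_products[OF assms(1,6)] by blast
    then show "g \<in> list_product ` ?L"
      using list_product_shorten[OF assms(1,2,4,5), of xs] by auto
  qed
  have fin: "finite ?L" by (rule finite_lists_length_le[OF assms(2)])
  have "card (generate G S) \<le> card (list_product ` ?L)"
    using sub fin by (intro card_mono) auto
  also have "\<dots> \<le> card ?L" by (rule card_image_le[OF fin])
  also have "\<dots> = (\<Sum>i\<le>card S * N. card S ^ i)" by (rule card_lists_length_le[OF assms(2)])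
  also have "\<dots> \<le> (\<Sum>i\<le>card S * N. s ^ i)" using assms(3) by (intro sum_mono power_mono) auto
  also have "\<dots> \<le> (\<Sum>i\<le>s * N. s ^ i)" using assms(3) by (intro sum_mono2) auto
  finally show ?thesis using sub fin by (auto intro: finite_subset)
qed

lemma dietzmann_finite_bound:
  assumes "conj_invariant G S" "finite S" "card S \<le> s" "0 < N" "\<And>x. x \<in> S \<Longrightarrow> x [^] N = \<one>"
  shows "finite (generate G S) \<and> card (generate G S) \<le> (\<Sum>i\<le>s * N. s ^ i)"
proof (rule generate_finite_bound)
  show S: "S \<subseteq> carrier G" using assms(1) by (simp add: conj_invariant_def)
  show "inv y \<otimes> x \<otimes> y \<in> S" if "x \<in> S" "y \<in> S" for x y
    using assms(1) that S by (auto simp: conj_invariant_def)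
  show "\<exists>zs. set zs \<subseteq> S \<and> length zs < N \<and> list_product zs = x [^] N" if "x \<in> S" for x
    using assms(4,5) that by (intro exI[of _ "[]"]) simp
  obtain k where k: "N = Suc k" using assms(4) by (cases N) auto
  show "\<exists>zs. set zs \<subseteq> S \<and> list_product zs = inv x" if "x \<in> S" for x
  proof (intro exI conjI)
    have x: "x \<in> carrier G" using S that by auto
    have "x [^] k \<otimes> x = \<one>" using assms(5)[OF that] k by simp
    then have "x [^] k = inv x" using x by (metis inv_equality nat_pow_closed)
    then show "list_product (replicate k x) = inv x" using x by (simp add: list_product_replicate)
    show "set (replicate k x) \<subseteq> S" using that by (simp add: set_replicate_conv_if)
  qed
qed (use assms in auto)

end


section \<open>Quotients on the same type\<close>

text \<open>Cosets are sets, so the usual quotient is a group on another type. The induction in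
  \<open>gamma_exponent_exists\<close> runs at one fixed type \<open>'a\<close> and applies its
  hypothesis to a quotient; therefore the quotient is carried over to chosen
  representatives.\<close>

lemma (in group) quotient_on_representatives:
  assumes "N \<lhd> G"
  obtains H :: "'a monoid" and h where "group_hom G H h" "h ` carrier G = carrier H"
    "\<And>g. g \<in> carrier G \<Longrightarrow> h g = \<one>\<^bsub>H\<^esub> \<longleftrightarrow> g \<in> N"
proof -
  interpret N: normal N G by fact
  \<comment> \<open>The choice depends on the coset alone, so \<open>h\<close> is constant on
    cosets.\<close>
  define h where "h g = (SOME x. x \<in> N #> g)" for g
  have in_coset: "h g \<in> N #> g" if "g \<in> carrier G" for g
    unfolding h_def using rcos_self[OF that N.is_subgroup] by (rule someI[where P = "\<lambda>x. x \<in> N #> g"])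
  have closed: "h g \<in> carrier G" if "g \<in> carrier G" for g
    using in_coset[OF that] r_coset_subset_G[OF N.subset that] by auto
  have coset: "N #> h g = N #> g" if "g \<in> carrier G" for g
    using repr_independence[OF in_coset[OF that] that N.is_subgroup] by simp
  have h_eq: "h a = h b \<longleftrightarrow> N #> a = N #> b" if "a \<in> carrier G" "b \<in> carrier G" for a b
  proof
    assume "h a = h b"
    then show "N #> a = N #> b" using coset that by metis
  qed (simp add: h_def)
  have h_mult: "h (h a \<otimes> h b) = h (a \<otimes> b)" if "a \<in> carrier G" "b \<in> carrier G" for a b
    using that closed by (subst h_eq) (auto simp: N.rcos_sum[symmetric] coset)
  define H :: "'a monoid" where
    "H = \<lparr>carrier = h ` carrier G, monoid.mult = (\<lambda>x y. h (x \<otimes> y)), one = h \<one>\<rparr>"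
  have hh: "h (a \<otimes> h b) = h (a \<otimes> b)" "h (h a \<otimes> b) = h (a \<otimes> b)"
    if "a \<in> carrier G" "b \<in> carrier G" for a b
    using that closed by (subst h_eq; auto simp: N.rcos_sum[symmetric] coset)+
  have "group H"
  proof (rule groupI)
    fix x assume "x \<in> carrier H"
    then obtain a where a: "a \<in> carrier G" "x = h a" by (auto simp: H_def)
    then show "\<exists>y\<in>carrier H. y \<otimes>\<^bsub>H\<^esub> x = \<one>\<^bsub>H\<^esub>"
      by (intro bexI[of _ "h (inv a)"]) (auto simp: H_def hh closed)
  qed (auto simp: H_def hh closed m_assoc)
  moreover have "h \<in> hom G H" by (rule homI) (auto simp: H_def hh closed)
  ultimately have hom: "group_hom G H h"
    using is_group by (simp add: group_hom_def group_hom_axioms_def)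
  have ker: "h g = \<one>\<^bsub>H\<^esub> \<longleftrightarrow> g \<in> N" if "g \<in> carrier G" for g
  proof -
    have "h g = \<one>\<^bsub>H\<^esub> \<longleftrightarrow> N #> g = N #> \<one>" using h_eq[OF that one_closed] by (simp add: H_def)
    also have "\<dots> \<longleftrightarrow> g \<in> N"
      using that N.subset coset_join1[OF _ that N.is_subgroup] coset_join2[OF that N.is_subgroup]
      by (auto simp: coset_mult_one)
    finally show ?thesis .
  qed
  show ?thesis by (rule that[OF hom _ ker]) (simp_all add: H_def)
qed

section \<open>The derived subgroup of a group generated by few conjugates\<close>

text \<open>On \<open>A\<close> the map \<open>g\<close> factors through \<open>f\<close>. This is
  how commutators are counted by the data that determine them.\<close>

lemma card_image_factor:
  assumes "finite B" "\<And>a. a \<in> A \<Longrightarrow> f a \<in> B"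
    and "\<And>a b. a \<in> A \<Longrightarrow> b \<in> A \<Longrightarrow> f a = f b \<Longrightarrow> g a = g b"
  shows "finite (g ` A) \<and> card (g ` A) \<le> card B"
proof -
  have "g a = g (inv_into A f (f a))" if "a \<in> A" for a
    using that by (intro assms(3)) (auto simp: inv_into_into f_inv_into_f)
  then have "g ` A \<subseteq> (\<lambda>b. g (inv_into A f b)) ` B"
    using assms(2) by blast
  then show ?thesis using assms(1) by (meson finite_surj surj_card_le)
qed

text \<open>The bound of \<open>generate_finite_bound\<close> for \<open>s = m^m * m^m\<close>, the
  number of pairs of maps from an m-element set to itself, and
  \<open>N = Suc (fact m)\<close>.\<close>

definition derived_bound :: "nat \<Rightarrow> nat" where
  "derived_bound m = (\<Sum>i\<le>(m ^ m * m ^ m) * Suc (fact m). (m ^ m * m ^ m) ^ i)"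

context group
begin

lemma conj_invariantD:
  assumes "conj_invariant G S" "s \<in> S"
  shows "s \<in> carrier G" "g \<in> carrier G \<Longrightarrow> inv g \<otimes> s \<otimes> g \<in> S"
    "g \<in> carrier G \<Longrightarrow> g \<otimes> s \<otimes> inv g \<in> S"
proof -
  show "s \<in> carrier G" "g \<in> carrier G \<Longrightarrow> inv g \<otimes> s \<otimes> g \<in> S"
    using assms by (auto simp: conj_invariant_def)
  have "inv (inv g) \<otimes> s \<otimes> inv g \<in> S" if "g \<in> carrier G"
    using assms inv_closed[OF that] unfolding conj_invariant_def by blast
  then show "g \<in> carrier G \<Longrightarrow> g \<otimes> s \<otimes> inv g \<in> S" by simp
qed

lemma conj_invariant_generate:
  assumes "conj_invariant G S"
  shows "conj_invariant G (generate G S)"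
proof -
  have S: "S \<subseteq> carrier G" using assms by (simp add: conj_invariant_def)
  have "generate G S \<lhd> G"
    using conj_invariantD(3)[OF assms] by (intro normal_generateI[OF S])
  then have "inv g \<otimes> v \<otimes> g \<in> generate G S" if "v \<in> generate G S" "g \<in> carrier G" for v g
    using that by (intro normal.inv_op_closed1)
  then show ?thesis using generate_incl[OF S] by (simp add: conj_invariant_def)
qed

lemma centralizes_generate:
  assumes "z \<in> carrier G" "S \<subseteq> carrier G" "\<And>s. s \<in> S \<Longrightarrow> z \<otimes> s = s \<otimes> z" "v \<in> generate G S"
  shows "z \<otimes> v = v \<otimes> z"
  using assms(4)
proof (induction rule: generate.induct)
  case (inv h)
  then have h: "h \<in> carrier G" "z \<otimes> h = h \<otimes> z" using assms by auto
  then have "inv h \<otimes> (z \<otimes> h) \<otimes> inv h = inv h \<otimes> (h \<otimes> z) \<otimes> inv h" by simp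
  then show ?case using h(1) assms(1) by (simp add: m_assoc)
next
  case (eng h1 h2)
  have h: "h1 \<in> carrier G" "h2 \<in> carrier G"
    using eng(1,2) generate_in_carrier[OF assms(2)] by auto
  have "z \<otimes> (h1 \<otimes> h2) = (z \<otimes> h1) \<otimes> h2" using h assms(1) by (simp add: m_assoc)
  also have "\<dots> = h1 \<otimes> (z \<otimes> h2)" using h assms(1) eng.IH(1) by (simp add: m_assoc)
  also have "\<dots> = (h1 \<otimes> h2) \<otimes> z" using h assms(1) eng.IH(2) by (simp add: m_assoc)
  finally show ?case .
qed (use assms in auto)

lemma same_action_centralizes_generate:
  assumes "a \<in> carrier G" "b \<in> carrier G" "S \<subseteq> carrier G"
    and same: "\<And>s. s \<in> S \<Longrightarrow> inv a \<otimes> s \<otimes> a = inv b \<otimes> s \<otimes> b" and "v \<in> generate G S"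
  shows "(a \<otimes> inv b) \<otimes> v = v \<otimes> (a \<otimes> inv b)"
proof (rule centralizes_generate[OF _ assms(3) _ assms(5)])
  fix s assume s: "s \<in> S"
  then have "s \<in> carrier G" using assms(3) by auto
  then have "(a \<otimes> inv b) \<otimes> s = a \<otimes> (inv b \<otimes> s \<otimes> b) \<otimes> inv b" using assms(1,2) by (simp add: m_assoc)
  also have "\<dots> = a \<otimes> (inv a \<otimes> s \<otimes> a) \<otimes> inv b" using same[OF s] by simp
  also have "\<dots> = s \<otimes> (a \<otimes> inv b)" using \<open>s \<in> carrier G\<close> assms(1,2) by (simp add: m_assoc)
  finally show "(a \<otimes> inv b) \<otimes> s = s \<otimes> (a \<otimes> inv b)" .
qed (use assms in simp)

text \<open>With the restriction, the actions on a finite conjugation invariant \<open>S\<close> lie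
  in the finite set \<open>S \<rightarrow>\<^sub>E S\<close> and can be counted.\<close>

definition conj_action :: "'a set \<Rightarrow> 'a \<Rightarrow> 'a \<Rightarrow> 'a" where
  "conj_action S a = restrict (\<lambda>s. inv a \<otimes> s \<otimes> a) S"

lemma conj_action_in:
  "conj_invariant G S \<Longrightarrow> a \<in> carrier G \<Longrightarrow> conj_action S a \<in> S \<rightarrow>\<^sub>E S"
  by (auto simp: conj_action_def conj_invariantD)

lemma conj_action_eq_centralizes:
  assumes "a \<in> carrier G" "b \<in> carrier G" "S \<subseteq> carrier G" "conj_action S a = conj_action S b"
    and "v \<in> generate G S"
  shows "(a \<otimes> inv b) \<otimes> v = v \<otimes> (a \<otimes> inv b)"
proof (rule same_action_centralizes_generate[OF assms(1-3) _ assms(5)])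
  fix s assume "s \<in> S"
  then show "inv a \<otimes> s \<otimes> a = inv b \<otimes> s \<otimes> b"
    using fun_cong[OF assms(4), of s] by (simp add: conj_action_def)
qed

text \<open>The conjugates of \<open>s\<close> under the powers of \<open>a\<close> stay in
  \<open>S\<close>, so some \<open>a^d\<close> with \<open>d\<close> dividing \<open>fact m\<close>
  commutes with \<open>s\<close>. While \<open>d\<close> varies with \<open>s\<close>, the exponent
  \<open>fact m\<close> serves all of \<open>S\<close> and hence the subgroup it generates.\<close>

lemma pow_fact_centralizes:
  assumes "conj_invariant G S" "finite S" "card S \<le> m" "a \<in> carrier G" "v \<in> generate G S"
  shows "a [^] (fact m :: nat) \<otimes> v = v \<otimes> a [^] (fact m :: nat)"
proof (rule centralizes_generate[OF _ _ _ assms(5)])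
  fix s assume s: "s \<in> S"
  have sc: "s \<in> carrier G" by (rule conj_invariantD(1)[OF assms(1) s])
  have inS: "inv (a [^] i) \<otimes> s \<otimes> a [^] i \<in> S" for i :: nat
    using conj_invariantD(2)[OF assms(1) s] assms(4) by simp
  obtain d i :: nat where "0 < d" and d: "d dvd fact m"
      "inv (a [^] i) \<otimes> s \<otimes> a [^] i = inv (a [^] (i + d)) \<otimes> s \<otimes> a [^] (i + d)"
    by (rule pigeonhole_period[where f = "\<lambda>i. inv (a [^] i) \<otimes> s \<otimes> a [^] i", OF assms(2,3) inS])
  have "a [^] (i + d) = a [^] d \<otimes> a [^] i" using assms(4) by (simp add: nat_pow_mult add.commute)
  then have "inv (a [^] i) \<otimes> s \<otimes> a [^] i = inv (a [^] i) \<otimes> (inv (a [^] d) \<otimes> s \<otimes> a [^] d) \<otimes> a [^] i"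
    using d(2) assms(4) sc by (simp add: inv_mult_group m_assoc)
  then have "s = inv (a [^] d) \<otimes> s \<otimes> a [^] d" using assms(4) sc by simp
  then have "a [^] d \<otimes> s = a [^] d \<otimes> (inv (a [^] d) \<otimes> s \<otimes> a [^] d)" by simp
  then have "a [^] d \<otimes> s = s \<otimes> a [^] d" using assms(4) sc by (simp add: m_assoc)
  moreover obtain c where "fact m = d * c" using d(1) by (elim dvdE)
  ultimately show "a [^] (fact m :: nat) \<otimes> s = s \<otimes> a [^] (fact m :: nat)"
    using commute_pow[of "a [^] d" s c] assms(4) sc by (simp add: nat_pow_pow)
qed (use assms conj_invariantD(1) in auto)

lemma commutator_mult_centralizing:
  assumes "a \<in> carrier G" "b \<in> carrier G" "z \<in> carrier G"
  shows "z \<otimes> b = b \<otimes> z \<Longrightarrow> commutator G (z \<otimes> a) b = commutator G a b"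
    and "z \<otimes> a = a \<otimes> z \<Longrightarrow> commutator G a (z \<otimes> b) = commutator G a b"
proof -
  show "commutator G (z \<otimes> a) b = commutator G a b" if "z \<otimes> b = b \<otimes> z"
  proof -
    have "commutator G z b = \<one>" using assms that by (simp add: commutator_eq_one_iff)
    then show ?thesis using assms by (simp add: commutator_mult_left)
  qed
  show "commutator G a (z \<otimes> b) = commutator G a b" if "z \<otimes> a = a \<otimes> z"
  proof -
    have "commutator G a z = \<one>" using assms that by (simp add: commutator_eq_one_iff)
    then show ?thesis using assms by (simp add: commutator_mult_right)
  qed
qed

text \<open>A bounded form of Schur's theorem. A commutator of elements of \<open>V\<close> depends
  only on their actions on \<open>W\<close>, which bounds the number of commutators. As
  \<open>[a,b]^(m!)\<close> centralizes \<open>V\<close>, \<open>commutator_pow_Suc\<close> makes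
  the power with exponent \<open>Suc (fact m)\<close> a shorter product of commutators.\<close>

lemma derived_generate_finite_bound:
  assumes W: "conj_invariant G W" "finite W" "card W \<le> m" "0 < m"
  defines "V \<equiv> generate G W"
  shows "finite (derived G V) \<and> card (derived G V) \<le> derived_bound m"
proof -
  have Wc: "W \<subseteq> carrier G" using W(1) by (simp add: conj_invariant_def)
  have Vc: "V \<subseteq> carrier G" unfolding V_def by (rule generate_incl[OF Wc])
  have V: "subgroup V G" unfolding V_def by (rule generate_is_subgroup[OF Wc])
  have Vconj: "conj_invariant G V" unfolding V_def by (rule conj_invariant_generate[OF W(1)])
  define S where "S = (\<lambda>(a, b). commutator G a b) ` (V \<times> V)"
  have SI: "commutator G a b \<in> S" if "a \<in> V" "b \<in> V" for a b using that by (auto simp: S_def)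
  have SV: "S \<subseteq> V"
    using subgroup.m_closed[OF V] subgroup.m_inv_closed[OF V] by (auto simp: S_def commutator_def)
  \<comment> \<open>\<open>derived_set\<close> consists of the commutators
    \<open>a b a^-1 b^-1\<close>; inverting both entries exchanges the two conventions.\<close>
  have derived_set: "derived_set G V = S"
  proof (intro equalityI subsetI)
    fix x assume "x \<in> derived_set G V"
    then obtain a b where ab: "a \<in> V" "b \<in> V" "x = a \<otimes> b \<otimes> inv a \<otimes> inv b" by auto
    then have "a \<in> carrier G" "b \<in> carrier G" using Vc by auto
    then have "x = commutator G (inv a) (inv b)" using ab(3) by (simp add: commutator_def)
    then show "x \<in> S" using SI ab subgroup.m_inv_closed[OF V] by simp
  next
    fix x assume "x \<in> S"
    then obtain a b where ab: "a \<in> V" "b \<in> V" "x = commutator G a b" by (auto simp: S_def)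
    then have "a \<in> carrier G" "b \<in> carrier G" using Vc by auto
    then have "x = inv a \<otimes> inv b \<otimes> inv (inv a) \<otimes> inv (inv b)" using ab(3) by (simp add: commutator_def)
    then show "x \<in> derived_set G V" using ab subgroup.m_inv_closed[OF V] by blast
  qed
  have "card (W \<rightarrow>\<^sub>E W) \<le> m ^ m"
  proof -
    have "card (W \<rightarrow>\<^sub>E W) = card W ^ card W" using W(2) by (simp add: card_funcsetE)
    also have "\<dots> \<le> m ^ card W" using W(3) by (intro power_mono) auto
    also have "\<dots> \<le> m ^ m" using W(3,4) by (intro power_increasing) auto
    finally show ?thesis .
  qed
  then have cardF: "card ((W \<rightarrow>\<^sub>E W) \<times> (W \<rightarrow>\<^sub>E W)) \<le> m ^ m * m ^ m"
    by (simp add: card_cartesian_product mult_le_mono)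
  have "finite S \<and> card S \<le> card ((W \<rightarrow>\<^sub>E W) \<times> (W \<rightarrow>\<^sub>E W))"
    unfolding S_def
  proof (rule card_image_factor[where f = "\<lambda>(a, b). (conj_action W a, conj_action W b)"])
    show "finite ((W \<rightarrow>\<^sub>E W) \<times> (W \<rightarrow>\<^sub>E W))" using W(2) by (intro finite_cartesian_product finite_PiE) auto
  next
    fix p assume "p \<in> V \<times> V"
    then show "(case p of (a, b) \<Rightarrow> (conj_action W a, conj_action W b)) \<in> (W \<rightarrow>\<^sub>E W) \<times> (W \<rightarrow>\<^sub>E W)"
      using conj_action_in[OF W(1)] Vc by (auto simp del: PiE_iff)
  next
    fix p p' assume p: "p \<in> V \<times> V" "p' \<in> V \<times> V"
      "(case p of (a, b) \<Rightarrow> (conj_action W a, conj_action W b)) =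
       (case p' of (a, b) \<Rightarrow> (conj_action W a, conj_action W b))"
    obtain a b a' b' where ab: "p = (a, b)" "p' = (a', b')" by (cases p, cases p')
    then have in_V: "a \<in> V" "b \<in> V" "a' \<in> V" "b' \<in> V"
      and act: "conj_action W a = conj_action W a'" "conj_action W b = conj_action W b'"
      using p by auto
    have in_G: "a \<in> carrier G" "b \<in> carrier G" "a' \<in> carrier G" "b' \<in> carrier G" using in_V Vc by auto
    \<comment> \<open>Elements with equal actions differ by a factor centralizing \<open>V\<close>,
      so \<open>a\<close> may be replaced by \<open>a'\<close> first and then \<open>b\<close> by
      \<open>b'\<close>.\<close>
    have "(a \<otimes> inv a') \<otimes> b = b \<otimes> (a \<otimes> inv a')" "(b \<otimes> inv b') \<otimes> a' = a' \<otimes> (b \<otimes> inv b')"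
      using in_G act in_V unfolding V_def by (simp_all only: conj_action_eq_centralizes[OF _ _ Wc])
    then have "commutator G ((a \<otimes> inv a') \<otimes> a') b = commutator G a' b"
        "commutator G a' ((b \<otimes> inv b') \<otimes> b') = commutator G a' b'"
      using in_G by (simp_all only: commutator_mult_centralizing m_closed inv_closed)
    then show "(case p of (a, b) \<Rightarrow> commutator G a b) = (case p' of (a, b) \<Rightarrow> commutator G a b)"
      using in_G ab by (simp add: m_assoc)
  qed
  then have S: "finite S" "card S \<le> m ^ m * m ^ m" using cardF by auto
  have "finite (generate G S) \<and>
      card (generate G S) \<le> (\<Sum>i\<le>(m ^ m * m ^ m) * Suc (fact m). (m ^ m * m ^ m) ^ i)"
  proof (rule generate_finite_bound[OF _ S])
    show "S \<subseteq> carrier G" using SV Vc by auto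
    show "inv y \<otimes> x \<otimes> y \<in> S" if "x \<in> S" "y \<in> S" for x y
    proof -
      obtain a b where ab: "a \<in> V" "b \<in> V" "x = commutator G a b" using \<open>x \<in> S\<close> by (auto simp: S_def)
      have "y \<in> carrier G" using that SV Vc by auto
      then have "inv y \<otimes> x \<otimes> y = commutator G (inv y \<otimes> a \<otimes> y) (inv y \<otimes> b \<otimes> y)"
        using ab Vc by (simp add: commutator_conj subset_iff)
      then show ?thesis using SI conj_invariantD(2)[OF Vconj] ab \<open>y \<in> carrier G\<close> by simp
    qed
    show "\<exists>zs. set zs \<subseteq> S \<and> length zs < Suc (fact m) \<and> list_product zs = x [^] Suc (fact m)"
      if "x \<in> S" for x
    proof -
      obtain a b where ab: "a \<in> V" "b \<in> V" "x = commutator G a b" using \<open>x \<in> S\<close> by (auto simp: S_def)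
      have c: "a \<in> carrier G" "b \<in> carrier G" using ab Vc by auto
      let ?c = "commutator G (inv b \<otimes> a \<otimes> b) b"
      have "commutator G a b [^] (fact m :: nat) \<otimes> b = b \<otimes> commutator G a b [^] (fact m :: nat)"
        using ab(2) c unfolding V_def by (intro pow_fact_centralizes[OF W(1-3)]) auto
      then have "x [^] Suc (fact m) = commutator G a (b \<otimes> b) \<otimes> ?c [^] (fact m - 1 :: nat)"
        unfolding ab(3) using c by (intro commutator_pow_Suc) auto
      also have "\<dots> = list_product (commutator G a (b \<otimes> b) # replicate (fact m - 1) ?c)"
        using c by (simp add: list_product_replicate)
      finally have "list_product (commutator G a (b \<otimes> b) # replicate (fact m - 1) ?c) = x [^] Suc (fact m)"
        by simp
      moreover have "?c \<in> S" "commutator G a (b \<otimes> b) \<in> S"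
        using ab conj_invariantD(2)[OF Vconj] c subgroup.m_closed[OF V] by (auto intro!: SI)
      then have "set (commutator G a (b \<otimes> b) # replicate (fact m - 1) ?c) \<subseteq> S"
        by (simp add: set_replicate_conv_if)
      moreover have "length (commutator G a (b \<otimes> b) # replicate (fact m - 1) ?c) < Suc (fact m)"
        by simp
      ultimately show ?thesis by blast
    qed
    show "\<exists>zs. set zs \<subseteq> S \<and> list_product zs = inv x" if "x \<in> S" for x
    proof -
      obtain a b where ab: "a \<in> V" "b \<in> V" "x = commutator G a b" using \<open>x \<in> S\<close> by (auto simp: S_def)
      have "commutator G b a = inv x"
        using ab Vc by (auto simp: commutator_def inv_mult_group m_assoc subset_iff)
      then show ?thesis using SI[OF ab(2,1)] ab Vc
        by (intro exI[of _ "[commutator G b a]"]) (auto simp: subset_iff)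
    qed
  qed
  then show ?thesis by (simp add: derived_def derived_set derived_bound_def)
qed

end

section \<open>Commutators generating an abelian subgroup\<close>

text \<open>What is retained of the value set of a non-commutator word, see
  \<open>power_rich_word_values\<close>. Both properties pass to images under surjective
  homomorphisms, as the induction requires.\<close>

definition power_rich :: "('a, 'b) monoid_scheme \<Rightarrow> nat \<Rightarrow> 'a set \<Rightarrow> bool" where
  "power_rich G k X \<longleftrightarrow> conj_invariant G X \<and> (\<forall>g\<in>carrier G. g [^]\<^bsub>G\<^esub> k \<in> X)"

text \<open>The setting of the inductive step once the derived subgroup of \<open>V\<close> has been
  factored out. \<open>Y\<close> stands for the values of the shorter commutator word,
  \<open>X\<close> for those of the last entry.\<close>

locale abelian_commutators = group G for G (structure) +
  fixes X Y W V :: "'a set" and k m :: nat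
  assumes Y: "conj_invariant G Y" and X: "power_rich G k X" and k: "0 < k"
  defines "W \<equiv> {commutator G y x | y x. y \<in> Y \<and> x \<in> X}"
    and "V \<equiv> generate G W"
  assumes finite_W: "finite W" and card_W: "card W \<le> m" "0 < m"
    and W_commute: "\<And>u v. u \<in> W \<Longrightarrow> v \<in> W \<Longrightarrow> u \<otimes> v = v \<otimes> u"
begin

section \<open>Membership in \<open>W\<close> and \<open>V\<close>, and commutators with elements of
  \<open>V\<close>\<close>

definition q :: nat where "q = k * fact m"

lemma X_conj: "conj_invariant G X"
  using X by (simp add: power_rich_def)

lemma X_closed: "x \<in> X \<Longrightarrow> x \<in> carrier G"
  by (rule conj_invariantD(1)[OF X_conj])

lemma X_pow: "g \<in> carrier G \<Longrightarrow> g [^] (k * i) \<in> X"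
  using X nat_pow_closed[of g i] by (simp add: power_rich_def nat_pow_pow[symmetric] mult.commute[of k i])

lemma Y_closed: "y \<in> Y \<Longrightarrow> y \<in> carrier G"
  by (rule conj_invariantD(1)[OF Y])

lemma W_I: "y \<in> Y \<Longrightarrow> x \<in> X \<Longrightarrow> commutator G y x \<in> W"
  by (auto simp: W_def)

lemma W_conj: "conj_invariant G W"
  unfolding conj_invariant_def
proof (intro conjI ballI subsetI)
  fix w assume "w \<in> W"
  then obtain y x where w: "y \<in> Y" "x \<in> X" "w = commutator G y x" by (auto simp: W_def)
  then show "w \<in> carrier G" using X_closed Y_closed by simp
  fix g assume g: "g \<in> carrier G"
  have "inv g \<otimes> w \<otimes> g = commutator G (inv g \<otimes> y \<otimes> g) (inv g \<otimes> x \<otimes> g)"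
    unfolding w(3) using w(1,2) g X_closed Y_closed by (intro commutator_conj)
  then show "inv g \<otimes> w \<otimes> g \<in> W"
    using W_I conj_invariantD(2)[OF Y w(1) g] conj_invariantD(2)[OF X_conj w(2) g] by simp
qed

lemma W_closed: "W \<subseteq> carrier G"
  using W_conj by (simp add: conj_invariant_def)

lemma V_conj: "conj_invariant G V"
  unfolding V_def by (rule conj_invariant_generate[OF W_conj])

lemmas V_closed = conj_invariantD(1)[OF V_conj]

lemma V_subgroup: "subgroup V G"
  unfolding V_def by (rule generate_is_subgroup[OF W_closed])

lemma V_I: "y \<in> Y \<Longrightarrow> x \<in> X \<Longrightarrow> commutator G y x \<in> V"
  unfolding V_def by (intro generate.incl W_I)

lemma V_mult: "u \<in> V \<Longrightarrow> v \<in> V \<Longrightarrow> u \<otimes> v \<in> V"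
  by (rule subgroup.m_closed[OF V_subgroup])

lemma V_inv: "u \<in> V \<Longrightarrow> inv u \<in> V"
  by (rule subgroup.m_inv_closed[OF V_subgroup])

lemma V_pow: "u \<in> V \<Longrightarrow> u [^] (n :: nat) \<in> V"
  by (induction n) (auto simp: V_mult subgroup.one_closed[OF V_subgroup])

lemma V_commute: "u \<in> V \<Longrightarrow> v \<in> V \<Longrightarrow> u \<otimes> v = v \<otimes> u"
proof -
  assume u: "u \<in> V" and v: "v \<in> V"
  have "u \<otimes> w = w \<otimes> u" if w: "w \<in> W" for w
  proof (rule sym, rule centralizes_generate[OF _ W_closed])
    show "w \<in> carrier G" using w W_closed by auto
    show "w \<otimes> s = s \<otimes> w" if "s \<in> W" for s using W_commute[OF w that] .
    show "u \<in> generate G W" using u by (simp add: V_def)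
  qed
  then show ?thesis using centralizes_generate[OF V_closed[OF u] W_closed] v by (simp add: V_def)
qed

lemma V_conj_trivial: "u \<in> V \<Longrightarrow> v \<in> V \<Longrightarrow> inv u \<otimes> v \<otimes> u = v"
  using V_commute[of v u] V_closed by (simp add: m_assoc)

lemma V_conj_trivial': "u \<in> V \<Longrightarrow> v \<in> V \<Longrightarrow> u \<otimes> v \<otimes> inv u = v"
  using V_commute[of u v] V_closed by (simp add: m_assoc)

lemma commutator_left_V: "u \<in> V \<Longrightarrow> g \<in> carrier G \<Longrightarrow> commutator G u g \<in> V"
proof -
  assume u: "u \<in> V" and g: "g \<in> carrier G"
  have "commutator G u g = inv u \<otimes> (inv g \<otimes> u \<otimes> g)"
    using V_closed[OF u] g by (simp add: commutator_def m_assoc)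
  then show ?thesis using V_mult[OF V_inv[OF u] conj_invariantD(2)[OF V_conj u g]] by simp
qed

lemma commutator_right_V: "u \<in> V \<Longrightarrow> g \<in> carrier G \<Longrightarrow> commutator G g u \<in> V"
proof -
  assume u: "u \<in> V" and g: "g \<in> carrier G"
  have "commutator G g u = (inv g \<otimes> inv u \<otimes> g) \<otimes> u"
    using V_closed[OF u] g by (simp add: commutator_def m_assoc)
  then show ?thesis using V_mult[OF conj_invariantD(2)[OF V_conj V_inv[OF u] g] u] by simp
qed

text \<open>\<open>commutator_mult_left\<close> conjugates the first factor by \<open>v\<close>,
  which has no effect in the abelian group \<open>V\<close>. Thus \<open>u \<mapsto> [u,g]\<close>
  is an endomorphism of \<open>V\<close>.\<close>

lemma commutator_left_V_mult:
  assumes "u \<in> V" "v \<in> V" "g \<in> carrier G"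
  shows "commutator G (u \<otimes> v) g = commutator G u g \<otimes> commutator G v g"
  using assms V_closed by (simp add: commutator_mult_left V_conj_trivial commutator_left_V)

lemma commutator_left_V_pow:
  assumes "u \<in> V" "g \<in> carrier G"
  shows "commutator G (u [^] (n :: nat)) g = commutator G u g [^] n"
proof (induction n)
  case 0
  then show ?case using assms by (simp add: commutator_def)
next
  case (Suc n)
  then show ?case using assms by (simp add: commutator_left_V_mult V_pow)
qed

lemma commutator_left_V_inv:
  assumes "u \<in> V" "g \<in> carrier G"
  shows "commutator G (inv u) g = inv (commutator G u g)"
proof -
  have "commutator G (inv u) g \<otimes> commutator G u g = \<one>"
    using assms V_closed[OF assms(1)] by (simp add: commutator_left_V_mult[symmetric] V_inv)
      (simp add: commutator_def)
  then show ?thesis using assms V_closed[OF assms(1)] by (intro inv_equality[symmetric]) auto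
qed

lemma commutator_right_V_pow:
  assumes "u \<in> V" "g \<in> carrier G"
  shows "commutator G g (u [^] (n :: nat)) = commutator G g u [^] n"
proof (induction n)
  case (Suc n)
  have "commutator G g (u [^] Suc n) = commutator G g u \<otimes> commutator G g (u [^] n)"
    using assms V_closed[OF assms(1)]
    by (simp add: commutator_mult_right V_conj_trivial commutator_right_V V_pow)
  also have "\<dots> = commutator G g (u [^] n) \<otimes> commutator G g u"
    using assms by (intro V_commute commutator_right_V V_pow)
  finally show ?case using Suc by simp
qed (use assms in simp)

text \<open>Two of the commutators \<open>[y,g^(ki)]\<close> in \<open>W\<close> agree. By
  \<open>[y,ts] = [y,s] (s^-1 [y,t] s)\<close>, the equality \<open>[y,ts] = [y,s]\<close> forces
  \<open>[y,t] = 1\<close> for \<open>t = g^(kd)\<close>, and \<open>g^q\<close> is a power of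
  \<open>t\<close>.\<close>

lemma commute_X_pow:
  assumes "y \<in> Y" "g \<in> carrier G"
  shows "commutator G y (g [^] q) = \<one>"
proof -
  note y = Y_closed[OF assms(1)]
  have inW: "commutator G y (g [^] (k * i)) \<in> W" for i by (intro W_I assms X_pow)
  obtain d i :: nat where "0 < d" and d: "d dvd fact m"
      "commutator G y (g [^] (k * i)) = commutator G y (g [^] (k * (i + d)))"
    by (rule pigeonhole_period[where f = "\<lambda>i. commutator G y (g [^] (k * i))", OF finite_W card_W(1) inW])
  let ?s = "g [^] (k * i)" and ?t = "g [^] (k * d)"
  have "g [^] (k * (i + d)) = ?t \<otimes> ?s" using assms by (simp add: nat_pow_mult algebra_simps)
  then have "commutator G y ?s \<otimes> (inv ?s \<otimes> commutator G y ?t \<otimes> ?s) = commutator G y ?s"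
    using d(2) assms y commutator_mult_right[of y ?t ?s] by simp
  then have "inv ?s \<otimes> commutator G y ?t \<otimes> ?s = \<one>" using assms y by simp
  then have "?s \<otimes> (inv ?s \<otimes> commutator G y ?t \<otimes> ?s) \<otimes> inv ?s = \<one>" using assms by simp
  then have "commutator G y ?t = \<one>" using assms y by (simp add: m_assoc)
  then have "?t \<otimes> y = y \<otimes> ?t" using assms y by (simp add: commutator_eq_one_iff)
  moreover obtain c where "fact m = d * c" using d(1) by (elim dvdE)
  ultimately have "g [^] q \<otimes> y = y \<otimes> g [^] q"
    using commute_pow[of ?t y c] assms y by (simp add: q_def nat_pow_pow mult.assoc)
  then show ?thesis using assms y by (simp add: commutator_eq_one_iff)
qed


subsection \<open>The torsion part\<close>

definition torsion :: "'a set" where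
  "torsion = {v \<in> V. v [^] q = \<one>}"

lemma torsion_V: "e \<in> torsion \<Longrightarrow> e \<in> V"
  by (simp add: torsion_def)

lemma torsion_mult: "d \<in> torsion \<Longrightarrow> e \<in> torsion \<Longrightarrow> d \<otimes> e \<in> torsion"
  using V_closed pow_mult_distrib[OF V_commute, of d e q] by (simp add: torsion_def V_mult)

lemma torsion_inv: "e \<in> torsion \<Longrightarrow> inv e \<in> torsion"
  using V_closed by (simp add: torsion_def V_inv nat_pow_inv)

lemma torsion_conj:
  assumes "e \<in> torsion" "g \<in> carrier G"
  shows "inv g \<otimes> e \<otimes> g \<in> torsion"
proof -
  have "e \<in> carrier G" using assms(1) by (simp add: torsion_def V_closed)
  then have "(inv g \<otimes> e \<otimes> g) [^] q = inv g \<otimes> e [^] q \<otimes> g"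
    using assms by (simp add: conj_pow)
  then show ?thesis
    using assms conj_invariantD(2)[OF V_conj] by (simp add: torsion_def)
qed

lemma torsion_conj': "e \<in> torsion \<Longrightarrow> g \<in> carrier G \<Longrightarrow> g \<otimes> e \<otimes> inv g \<in> torsion"
  using torsion_conj[of e "inv g"] by simp

lemma torsion_one: "\<one> \<in> torsion"
  by (simp add: torsion_def subgroup.one_closed[OF V_subgroup])

text \<open>The preimage of the centralizer of the image of \<open>X\<close> in the quotient by
  \<open>torsion\<close>. It is normal because \<open>X\<close> and \<open>torsion\<close> are
  invariant under conjugation.\<close>

definition torsion_centralizer :: "'a set" where
  "torsion_centralizer = {g \<in> carrier G. \<forall>x\<in>X. commutator G g x \<in> torsion}"

lemma normal_torsion_centralizer: "torsion_centralizer \<lhd> G"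
proof (rule normal_invI)
  show "subgroup torsion_centralizer G"
  proof (rule subgroupI)
    have "commutator G \<one> x \<in> torsion" if "x \<in> X" for x
      using X_closed[OF that] torsion_one by (simp add: commutator_def)
    then show "torsion_centralizer \<noteq> {}" by (auto simp: torsion_centralizer_def)
  next
    fix a assume a: "a \<in> torsion_centralizer"
    have "commutator G (inv a) x \<in> torsion" if "x \<in> X" for x
    proof -
      have c: "a \<in> carrier G" "x \<in> carrier G" "commutator G a x \<in> torsion"
        using a that X_closed by (auto simp: torsion_centralizer_def)
      have "commutator G (inv a) x = inv (a \<otimes> commutator G a x \<otimes> inv a)"
        using c(1,2) by (simp add: commutator_def m_assoc inv_mult_group)
      then show ?thesis using torsion_inv[OF torsion_conj'[OF c(3,1)]] by simp
    qed
    then show "inv a \<in> torsion_centralizer" using a by (simp add: torsion_centralizer_def)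
  next
    fix a b assume ab: "a \<in> torsion_centralizer" "b \<in> torsion_centralizer"
    have "commutator G (a \<otimes> b) x \<in> torsion" if "x \<in> X" for x
      using ab that X_closed
      by (auto simp: torsion_centralizer_def commutator_mult_left intro!: torsion_mult torsion_conj)
    then show "a \<otimes> b \<in> torsion_centralizer" using ab by (simp add: torsion_centralizer_def)
  qed (auto simp: torsion_centralizer_def)
next
  fix g d assume g: "g \<in> carrier G" and d: "d \<in> torsion_centralizer"
  have "commutator G (g \<otimes> d \<otimes> inv g) x \<in> torsion" if "x \<in> X" for x
  proof -
    have c: "d \<in> carrier G" "x \<in> carrier G" using d X_closed that by (auto simp: torsion_centralizer_def)
    have "inv g \<otimes> x \<otimes> g \<in> X" by (rule conj_invariantD(2)[OF X_conj that g])
    then have "commutator G d (inv g \<otimes> x \<otimes> g) \<in> torsion" using d by (simp add: torsion_centralizer_def)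
    then have "g \<otimes> commutator G d (inv g \<otimes> x \<otimes> g) \<otimes> inv g \<in> torsion" using g by (rule torsion_conj')
    also have "g \<otimes> commutator G d (inv g \<otimes> x \<otimes> g) \<otimes> inv g = commutator G (g \<otimes> d \<otimes> inv g) x"
      using c g by (simp add: commutator_def m_assoc inv_mult_group)
    finally show ?thesis .
  qed
  then show "g \<otimes> d \<otimes> inv g \<in> torsion_centralizer"
    using d g by (simp add: torsion_centralizer_def)
qed

text \<open>As \<open>c\<close> centralizes \<open>V\<close>, expanding \<open>[y,c^(n+1)]\<close>
  gives \<open>[y,c^n] = [y,c]^n\<close>. The element \<open>c\<close> need not be in
  \<open>X\<close>, but its powers \<open>c^(ki)\<close> are.\<close>

lemma commutator_centralizing_torsion:
  assumes "y \<in> Y" "c \<in> carrier G" "commutator G y c \<in> V"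
    and comm: "\<And>v. v \<in> V \<Longrightarrow> c \<otimes> v = v \<otimes> c"
  shows "commutator G y c \<in> torsion"
proof -
  note y = Y_closed[OF assms(1)]
  let ?v = "commutator G y c"
  have pow: "commutator G y (c [^] n) = ?v [^] n" for n :: nat
  proof (induction n)
    case (Suc n)
    have "inv c \<otimes> ?v [^] n \<otimes> c = ?v [^] n"
      using comm[OF V_pow[OF assms(3), of n], symmetric] y assms(2) by (simp add: m_assoc)
    then have "commutator G y (c [^] Suc n) = ?v \<otimes> ?v [^] n"
      using Suc y assms(2) by (simp add: commutator_mult_right)
    then show ?case using nat_pow_Suc2[of ?v n] y assms(2) by simp
  qed (use y in simp)
  have "?v [^] q = \<one>"
  proof -
    have "(?v [^] k) [^] i \<otimes> \<one> \<in> W" for i :: nat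
      using W_I[OF assms(1) X_pow[OF assms(2)], of i] y assms(2) by (simp add: pow nat_pow_pow)
    then have "(?v [^] k) [^] (fact m :: nat) = \<one>"
      using y assms(2) by (intro pow_fact_eq_one[OF finite_W card_W(1), where c = \<one>]) auto
    then show ?thesis using y assms(2) by (simp add: q_def nat_pow_pow)
  qed
  then show ?thesis using assms(3) by (simp add: torsion_def)
qed

text \<open>Write \<open>x = c x'\<close>. Then \<open>[y,x]\<close> is \<open>[y,x']\<close> times
  a conjugate of \<open>[y,c]\<close>, and \<open>[y,c]\<close> is torsion because \<open>c\<close>
  centralizes \<open>V\<close>.\<close>

lemma commutator_mod_torsion:
  assumes "y \<in> Y" "x \<in> X" "x' \<in> X" "conj_action W x = conj_action W x'"
  shows "\<exists>e\<in>torsion. commutator G y x = commutator G y x' \<otimes> e"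
proof -
  note c = Y_closed[OF assms(1)] X_closed[OF assms(2)] X_closed[OF assms(3)]
  let ?c = "x \<otimes> inv x'"
  \<comment> \<open>Since \<open>?c\<close> need not lie in \<open>X\<close>, membership of
    \<open>[y,c]\<close> in \<open>V\<close> is read off this expansion.\<close>
  have "commutator G y ?c = commutator G y (inv x') \<otimes> (x' \<otimes> commutator G y x \<otimes> inv x')"
    using c by (simp add: commutator_mult_right)
  also have "commutator G y (inv x') = inv (x' \<otimes> commutator G y x' \<otimes> inv x')"
    using c by (rule_tac commutator_inv_right)
  finally have "commutator G y ?c \<in> V"
    using assms c V_I conj_invariantD(3)[OF V_conj] by (simp add: V_mult V_inv)
  then have "commutator G y ?c \<in> torsion"
    using c conj_action_eq_centralizes[OF c(2,3) W_closed assms(4)] assms(1)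
    by (intro commutator_centralizing_torsion) (auto simp: V_def)
  then have "inv x' \<otimes> commutator G y ?c \<otimes> x' \<in> torsion" using c by (intro torsion_conj)
  moreover have "commutator G y x = commutator G y x' \<otimes> (inv x' \<otimes> commutator G y ?c \<otimes> x')"
    using c commutator_mult_right[of y ?c x'] by (simp add: m_assoc)
  ultimately show ?thesis by blast
qed

text \<open>One representative \<open>x\<close> is fixed for every action on \<open>W\<close>
  induced by \<open>X\<close>, and \<open>y\<close> is recorded by its commutators with these. By
  \<open>commutator_mod_torsion\<close> they determine every \<open>[y,x]\<close> modulo
  \<open>torsion\<close>.\<close>

definition commutator_profile :: "'a \<Rightarrow> ('a \<Rightarrow> 'a) \<Rightarrow> 'a" where
  "commutator_profile y =
     restrict (\<lambda>f. commutator G y (inv_into X (conj_action W) f)) (conj_action W ` X)"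

lemma commutator_profile_eq:
  assumes "y \<in> Y" "y' \<in> Y" "commutator_profile y = commutator_profile y'"
  shows "y' \<otimes> inv y \<in> torsion_centralizer"
proof -
  note c = Y_closed[OF assms(1)] Y_closed[OF assms(2)]
  have "commutator G (y' \<otimes> inv y) x \<in> torsion" if x: "x \<in> X" for x
  proof -
    note xc = X_closed[OF x]
    define x' where "x' = inv_into X (conj_action W) (conj_action W x)"
    have x': "x' \<in> X" "conj_action W x = conj_action W x'"
      unfolding x'_def using x by (simp_all add: inv_into_into f_inv_into_f)
    have eq: "commutator G y x' = commutator G y' x'"
      using fun_cong[OF assms(3), of "conj_action W x"] x by (simp add: commutator_profile_def x'_def)
    obtain e e' where e: "e \<in> torsion" "commutator G y x = commutator G y x' \<otimes> e"
      and e': "e' \<in> torsion" "commutator G y' x = commutator G y x' \<otimes> e'"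
      using commutator_mod_torsion[OF assms(1) x x'] commutator_mod_torsion[OF assms(2) x x'] eq by metis
    let ?u = "commutator G y x'"
    have u: "?u \<in> carrier G" using c X_closed[OF x'(1)] by simp
    have ec: "e \<in> carrier G" "e' \<in> carrier G" using e e' V_closed torsion_V by auto
    \<comment> \<open>Both commutators begin with the same \<open>?u\<close>, so that only a
      conjugate of \<open>e' e^-1\<close> survives.\<close>
    have "commutator G (y' \<otimes> inv y) x = y \<otimes> commutator G y' x \<otimes> inv (commutator G y x) \<otimes> inv y"
      using c xc by (simp add: commutator_def m_assoc inv_mult_group)
    also have "\<dots> = y \<otimes> (?u \<otimes> (e' \<otimes> inv e) \<otimes> inv ?u) \<otimes> inv y"
      unfolding e(2) e'(2) using u ec c by (simp add: m_assoc inv_mult_group)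
    also have "\<dots> \<in> torsion"
      using e(1) e'(1) u c by (intro torsion_conj' torsion_mult torsion_inv)
    finally show ?thesis .
  qed
  then show ?thesis using c by (simp add: torsion_centralizer_def)
qed

text \<open>\<open>X\<close> induces at most \<open>m^m\<close> actions on \<open>W\<close>, and a
  profile assigns to each one of at most \<open>m\<close> elements of \<open>W\<close>. Elements of
  \<open>Y\<close> with equal profiles have equal images under \<open>h\<close>.\<close>

lemma card_image_torsion_quotient:
  assumes "group_hom G H h" "\<And>g. g \<in> carrier G \<Longrightarrow> h g = \<one>\<^bsub>H\<^esub> \<longleftrightarrow> g \<in> torsion_centralizer"
  shows "finite (h ` Y) \<and> card (h ` Y) \<le> m ^ (m ^ m)"
proof -
  interpret h: group_hom G H h by fact
  let ?F = "conj_action W ` X"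
  have "?F \<subseteq> W \<rightarrow>\<^sub>E W" using conj_action_in[OF W_conj] X_closed by blast
  moreover have fin: "finite (W \<rightarrow>\<^sub>E W)" using finite_W by (intro finite_PiE) auto
  ultimately have F: "finite ?F" "card ?F \<le> card W ^ card W"
    using card_mono[of "W \<rightarrow>\<^sub>E W" ?F] finite_W by (auto simp: card_funcsetE intro: finite_subset)
  have *: "finite (h ` Y) \<and> card (h ` Y) \<le> card (?F \<rightarrow>\<^sub>E W)"
  proof (rule card_image_factor[where f = commutator_profile])
    show "finite (?F \<rightarrow>\<^sub>E W)" using F finite_W by (intro finite_PiE) auto
    show "commutator_profile y \<in> ?F \<rightarrow>\<^sub>E W" if "y \<in> Y" for y
      using that by (auto simp: commutator_profile_def intro!: W_I inv_into_into)
    show "h y = h y'" if "y \<in> Y" "y' \<in> Y" "commutator_profile y = commutator_profile y'" for y y'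
    proof -
      note c = Y_closed[OF that(1)] Y_closed[OF that(2)]
      have "h (y' \<otimes> inv y) = \<one>\<^bsub>H\<^esub>"
        using assms(2)[of "y' \<otimes> inv y"] commutator_profile_eq[OF that] c by blast
      then have "h y' \<otimes>\<^bsub>H\<^esub> inv\<^bsub>H\<^esub> h y = \<one>\<^bsub>H\<^esub>" using c by simp
      then have "h y' \<otimes>\<^bsub>H\<^esub> inv\<^bsub>H\<^esub> h y \<otimes>\<^bsub>H\<^esub> h y = h y" using c by simp
      then show ?thesis using c by (simp add: h.H.m_assoc)
    qed
  qed
  have "card (?F \<rightarrow>\<^sub>E W) = card W ^ card ?F" using F by (simp add: card_funcsetE)
  also have "\<dots> \<le> m ^ card ?F" using card_W by (intro power_mono) auto
  also have "\<dots> \<le> m ^ (m ^ m)"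
  proof (rule power_increasing)
    have "card W ^ card W \<le> m ^ card W" using card_W by (intro power_mono) auto
    also have "\<dots> \<le> m ^ m" using card_W by (intro power_increasing) auto
    finally show "card ?F \<le> m ^ m" using F by simp
  qed (use card_W in simp)
  finally show ?thesis using * by simp
qed


subsection \<open>Exponents of commutators\<close>

text \<open>With \<open>a = [y,x^n]\<close> one has \<open>[y,x^(n+1)] = [y,x] a [a,x]\<close>. The
  corrections \<open>[a,x]\<close> combine into a single \<open>[u,x]\<close>, because
  \<open>u \<mapsto> [u,x]\<close> is a homomorphism on \<open>V\<close>.\<close>

lemma pow_eq_commutator_mult:
  assumes "y \<in> Y" "x \<in> X"
  shows "commutator G y (x [^] (n :: nat)) \<in> V \<and>
    (\<exists>u\<in>V. commutator G y x [^] n = commutator G y (x [^] (n :: nat)) \<otimes> commutator G u x)"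
proof (induction n)
  case 0
  have "commutator G \<one> x = \<one>" using X_closed[OF assms(2)] by (simp add: commutator_def)
  then show ?case using Y_closed[OF assms(1)] subgroup.one_closed[OF V_subgroup]
    by (auto intro!: bexI[of _ \<one>])
next
  case (Suc n)
  note c = Y_closed[OF assms(1)] X_closed[OF assms(2)]
  let ?v = "commutator G y x" and ?a = "commutator G y (x [^] n)"
  have v: "?v \<in> V" by (rule V_I[OF assms])
  obtain u where a: "?a \<in> V" and u: "u \<in> V" "?v [^] n = ?a \<otimes> commutator G u x" using Suc by blast
  have "inv x \<otimes> ?a \<otimes> x = ?a \<otimes> commutator G ?a x"
    using c by (simp add: commutator_def[of G ?a] m_assoc)
  then have *: "commutator G y (x [^] Suc n) = ?v \<otimes> (?a \<otimes> commutator G ?a x)"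
    using c by (simp add: commutator_mult_right)
  have in_V: "commutator G ?a x \<in> V" "commutator G u x \<in> V" using a u c by (auto intro: commutator_left_V)
  note in_G = V_closed[OF v] V_closed[OF a] V_closed[OF in_V(1)] V_closed[OF in_V(2)] V_closed[OF u(1)]
  \<comment> \<open>The next witness is \<open>a^-1 u\<close>, whose commutator with
    \<open>x\<close> cancels \<open>[a,x]\<close>.\<close>
  have "commutator G (inv ?a \<otimes> u) x = inv (commutator G ?a x) \<otimes> commutator G u x"
    using a u c by (simp add: commutator_left_V_mult commutator_left_V_inv V_inv)
  then have "commutator G y (x [^] Suc n) \<otimes> commutator G (inv ?a \<otimes> u) x =
      ?v \<otimes> (?a \<otimes> commutator G u x)"
    unfolding * using in_G by (simp add: m_assoc)
  also have "\<dots> = ?v [^] Suc n"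
    using u(2) nat_pow_Suc2[OF in_G(1), of n] by simp
  finally have "?v [^] Suc n = commutator G y (x [^] Suc n) \<otimes> commutator G (inv ?a \<otimes> u) x" by simp
  moreover have "commutator G y (x [^] Suc n) \<in> V" unfolding * by (intro V_mult v a in_V)
  ultimately show ?case using V_mult[OF V_inv[OF a] u(1)] by blast
qed

text \<open>Replacing \<open>x\<close> by its conjugates under \<open>u\<^sup>i\<close> multiplies \<open>[y,x]\<close> by powers of \<open>[[u,x],y]\<close>.\<close>

lemma commute_commutator_pow:
  assumes "y \<in> Y" "x \<in> X" "u \<in> V"
  shows "commutator G u x [^] (fact m :: nat) \<otimes> y = y \<otimes> commutator G u x [^] (fact m :: nat)"
proof -
  note c = Y_closed[OF assms(1)] X_closed[OF assms(2)] V_closed[OF assms(3)]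
  define t where "t = commutator G u x"
  have t: "t \<in> V" unfolding t_def using assms(3) c(2) by (rule commutator_left_V)
  note tc = V_closed[OF t]
  let ?v = "commutator G y x" and ?c = "commutator G y t"
  have cV: "?c \<in> V" using t c(1) by (rule commutator_right_V)
  \<comment> \<open>The conjugate of \<open>x\<close> under \<open>u^i\<close> is
    \<open>x t^(-i)\<close>, and \<open>[y,x t^(-i)] = [y,t]^(-i) [y,x]\<close>. As these are at
    most \<open>m\<close> elements, the order of \<open>[y,t]\<close> divides
    \<open>fact m\<close>.\<close>
  have "inv ?c [^] i \<otimes> ?v \<in> W" for i :: nat
  proof -
    have tV: "t [^] i \<in> V" using t by (rule V_pow)
    have "inv (u [^] i) \<otimes> x \<otimes> u [^] i = x \<otimes> inv (commutator G (u [^] i) x)"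
      using c by (simp add: commutator_def m_assoc inv_mult_group)
    also have "\<dots> = x \<otimes> inv (t [^] i)"
      unfolding t_def using assms(3) c(2) by (simp add: commutator_left_V_pow)
    finally have "x \<otimes> inv (t [^] i) \<in> X"
      using conj_invariantD(2)[OF X_conj assms(2), of "u [^] i"] c by simp
    then have W: "commutator G y (x \<otimes> inv (t [^] i)) \<in> W" by (rule W_I[OF assms(1)])
    have "commutator G y (x \<otimes> inv (t [^] i)) =
        commutator G y (inv (t [^] i)) \<otimes> (t [^] i \<otimes> ?v \<otimes> inv (t [^] i))"
      using c tc by (simp add: commutator_mult_right)
    also have "t [^] i \<otimes> ?v \<otimes> inv (t [^] i) = ?v" using tV V_I[OF assms(1,2)] by (rule V_conj_trivial')
    also have "commutator G y (inv (t [^] i)) = inv (t [^] i \<otimes> commutator G y (t [^] i) \<otimes> inv (t [^] i))"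
      using c tc by (intro commutator_inv_right) auto
    also have "t [^] i \<otimes> commutator G y (t [^] i) \<otimes> inv (t [^] i) = ?c [^] i"
      using V_conj_trivial'[OF tV V_pow[OF cV]] commutator_right_V_pow[OF t c(1)] by simp
    also have "inv (?c [^] i) = inv ?c [^] i" using V_closed[OF cV] by (simp add: nat_pow_inv)
    finally show ?thesis using W by simp
  qed
  then have "inv ?c [^] (fact m :: nat) = \<one>"
    using V_closed[OF cV] c by (intro pow_fact_eq_one[OF finite_W card_W(1), where c = ?v]) auto
  then have "inv (?c [^] (fact m :: nat)) = \<one>" using V_closed[OF cV] by (simp add: nat_pow_inv)
  then have "?c [^] (fact m :: nat) = \<one>" using V_closed[OF cV] by (simp add: inv_eq_1_iff)
  then have "commutator G y (t [^] (fact m :: nat)) = \<one>" using t c by (simp add: commutator_right_V_pow)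
  then show ?thesis unfolding t_def[symmetric] using c tc by (simp add: commutator_eq_one_iff)
qed

text \<open>Each factor of the exponent has its own source: the first \<open>q\<close> makes
  \<open>v^q\<close> a commutator \<open>[u,x]\<close>, \<open>fact m\<close> makes it commute with
  \<open>y\<close>, \<open>N\<close> takes \<open>y\<close> into \<open>torsion_centralizer\<close>,
  and the last \<open>q\<close> kills the torsion.\<close>

lemma commutator_pow_exponent:
  assumes "y \<in> Y" "x \<in> X" "y [^] N \<in> torsion_centralizer"
  shows "commutator G y x [^] (q * fact m * N * q) = \<one>"
proof -
  note c = Y_closed[OF assms(1)] X_closed[OF assms(2)]
  let ?v = "commutator G y x"
  have v: "?v \<in> V" by (rule V_I[OF assms(1,2)])
  note vc = V_closed[OF v]
  obtain u where u: "u \<in> V" "?v [^] q = commutator G y (x [^] q) \<otimes> commutator G u x"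
    using pow_eq_commutator_mult[OF assms(1,2)] by blast
  define p where "p = q * fact m"
  have "?v [^] q = commutator G u x"
    using u c V_closed[OF u(1)] commute_X_pow[OF assms(1) c(2)] by simp
  then have "?v [^] p = commutator G u x [^] (fact m :: nat)"
    using vc by (simp add: p_def nat_pow_pow[symmetric])
  then have vp: "?v [^] p \<otimes> y = y \<otimes> ?v [^] p"
    using commute_commutator_pow[OF assms(1,2) u(1)] by simp
  \<comment> \<open>Since \<open>v^p\<close> commutes with \<open>y\<close>, conjugation by
    \<open>y\<close> does not change the p-th power of \<open>[y^n,x]\<close>.\<close>
  have "commutator G (y [^] n) x \<in> V \<and> commutator G (y [^] n) x [^] p = ?v [^] (p * n)" for n :: nat
  proof (induction n)
    case 0
    have "commutator G \<one> x = \<one>" using c by (simp add: commutator_def)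
    then show ?case using subgroup.one_closed[OF V_subgroup] by simp
  next
    case (Suc n)
    let ?a = "commutator G (y [^] n) x"
    have a: "?a \<in> V" "?a [^] p = ?v [^] (p * n)" using Suc by auto
    have b: "inv y \<otimes> ?a \<otimes> y \<in> V" using conj_invariantD(2)[OF V_conj a(1) c(1)] .
    have "?v [^] (p * n) \<otimes> y = y \<otimes> ?v [^] (p * n)"
      using commute_pow[OF _ c(1) vp, of n] vc by (simp add: nat_pow_pow)
    then have "(inv y \<otimes> ?a \<otimes> y) [^] p = ?v [^] (p * n)"
      using conj_pow[OF V_closed[OF a(1)] c(1), of p] a(2) c vc by (simp add: m_assoc)
    then have "((inv y \<otimes> ?a \<otimes> y) \<otimes> ?v) [^] p = ?v [^] (p * n) \<otimes> ?v [^] p"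
      using pow_mult_distrib[OF V_commute[OF b v] V_closed[OF b] vc, of p] by simp
    also have "\<dots> = ?v [^] (p * Suc n)" using vc by (simp add: nat_pow_mult add.commute)
    also have "(inv y \<otimes> ?a \<otimes> y) \<otimes> ?v = commutator G (y [^] Suc n) x"
      using c by (simp add: commutator_mult_left)
    finally show ?case
      using V_mult[OF b v] c by (simp add: commutator_mult_left)
  qed
  then have "commutator G (y [^] N) x [^] p = ?v [^] (p * N)" by blast
  moreover have "commutator G (y [^] N) x [^] q = \<one>"
    using assms(2,3) by (simp add: torsion_centralizer_def torsion_def)
  then have "(commutator G (y [^] N) x [^] p) [^] q = \<one>"
    using c by (simp add: nat_pow_pow mult.commute[of p q]) (simp add: nat_pow_pow[symmetric])
  ultimately show ?thesis using vc by (simp add: nat_pow_pow p_def)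
qed

end

section \<open>Values of lower central words on power-rich sets\<close>

text \<open>The index is shifted: \<open>gamma_values G X n\<close> has entries from
  \<open>X 1\<close> to \<open>X (n + 1)\<close> and belongs to \<open>gamma_word (Suc n)\<close>.
  The entries vary independently, which reflects the disjointness of the words.\<close>

primrec gamma_values :: "('a, 'b) monoid_scheme \<Rightarrow> (nat \<Rightarrow> 'a set) \<Rightarrow> nat \<Rightarrow> 'a set" where
  "gamma_values G X 0 = X 1"
| "gamma_values G X (Suc n) =
     {commutator G y x | y x. y \<in> gamma_values G X n \<and> x \<in> X (Suc (Suc n))}"

lemma (in group_hom) hom_commutator:
  "x \<in> carrier G \<Longrightarrow> y \<in> carrier G \<Longrightarrow> h (commutator G x y) = commutator H (h x) (h y)"
  by (simp add: commutator_def)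

lemma (in group) conj_invariant_gamma_values:
  assumes "\<And>i. i \<in> {1..Suc n} \<Longrightarrow> conj_invariant G (X i)"
  shows "conj_invariant G (gamma_values G X n)"
  using assms
proof (induction n)
  case (Suc n)
  have Y: "conj_invariant G (gamma_values G X n)" using Suc by simp
  have X: "conj_invariant G (X (Suc (Suc n)))" using Suc.prems by simp
  show ?case
    unfolding conj_invariant_def
  proof (intro conjI ballI subsetI)
    fix w assume "w \<in> gamma_values G X (Suc n)"
    then obtain y x where w: "y \<in> gamma_values G X n" "x \<in> X (Suc (Suc n))" "w = commutator G y x" by auto
    note c = conj_invariantD(1)[OF Y w(1)] conj_invariantD(1)[OF X w(2)]
    show "w \<in> carrier G" using c w(3) by simp
    fix g assume g: "g \<in> carrier G"
    have "inv g \<otimes> w \<otimes> g = commutator G (inv g \<otimes> y \<otimes> g) (inv g \<otimes> x \<otimes> g)"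
      unfolding w(3) using c g by (intro commutator_conj)
    then show "inv g \<otimes> w \<otimes> g \<in> gamma_values G X (Suc n)"
      using conj_invariantD(2)[OF Y w(1) g] conj_invariantD(2)[OF X w(2) g] by auto
  qed
qed simp

lemma (in group_hom) conj_invariant_image:
  assumes "conj_invariant G S" "h ` carrier G = carrier H"
  shows "conj_invariant H (h ` S)"
  unfolding conj_invariant_def
proof (intro conjI ballI)
  show "h ` S \<subseteq> carrier H" using assms by (auto simp: conj_invariant_def)
next
  fix s g assume "s \<in> h ` S" "g \<in> carrier H"
  then obtain t a where t: "t \<in> S" "s = h t" "a \<in> carrier G" "g = h a" using assms(2) by blast
  have "t \<in> carrier G" by (rule G.conj_invariantD(1)[OF assms(1) t(1)])
  then have "inv\<^bsub>H\<^esub> g \<otimes>\<^bsub>H\<^esub> s \<otimes>\<^bsub>H\<^esub> g = h (inv a \<otimes> t \<otimes> a)" using t by simp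
  then show "inv\<^bsub>H\<^esub> g \<otimes>\<^bsub>H\<^esub> s \<otimes>\<^bsub>H\<^esub> g \<in> h ` S"
    using G.conj_invariantD(2)[OF assms(1) t(1,3)] by simp
qed

lemma (in group_hom) power_rich_image:
  assumes "power_rich G k X" "h ` carrier G = carrier H"
  shows "power_rich H k (h ` X)"
  unfolding power_rich_def
proof (intro conjI ballI)
  show "conj_invariant H (h ` X)"
    using assms by (intro conj_invariant_image) (auto simp: power_rich_def)
next
  fix g assume "g \<in> carrier H"
  then obtain a where a: "a \<in> carrier G" "g = h a" using assms(2) by blast
  then have "g [^]\<^bsub>H\<^esub> k = h (a [^] k)" by (simp add: hom_nat_pow)
  then show "g [^]\<^bsub>H\<^esub> k \<in> h ` X" using assms(1) a by (simp add: power_rich_def)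
qed

lemma (in group_hom) gamma_values_image:
  assumes "\<And>i. i \<in> {1..Suc n} \<Longrightarrow> conj_invariant G (X i)"
  shows "h ` gamma_values G X n = gamma_values H (\<lambda>i. h ` X i) n"
  using assms
proof (induction n)
  case (Suc n)
  have eq: "h (commutator G y x) = commutator H (h y) (h x)"
    if "y \<in> gamma_values G X n" "x \<in> X (Suc (Suc n))" for x y
  proof (rule hom_commutator)
    show "y \<in> carrier G"
      using that Suc.prems by (intro G.conj_invariantD(1)[OF G.conj_invariant_gamma_values]) auto
    show "x \<in> carrier G"
      using that Suc.prems by (intro G.conj_invariantD(1)[of "X (Suc (Suc n))"]) auto
  qed
  have IH: "gamma_values H (\<lambda>i. h ` X i) n = h ` gamma_values G X n" using Suc by simp
  show ?case
  proof (intro equalityI subsetI)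
    fix w assume "w \<in> h ` gamma_values G X (Suc n)"
    then obtain y x where "y \<in> gamma_values G X n" "x \<in> X (Suc (Suc n))" "w = h (commutator G y x)" by auto
    then show "w \<in> gamma_values H (\<lambda>i. h ` X i) (Suc n)" using eq IH by auto
  next
    fix w assume "w \<in> gamma_values H (\<lambda>i. h ` X i) (Suc n)"
    then obtain y x where "y \<in> gamma_values G X n" "x \<in> X (Suc (Suc n))" "w = commutator H (h y) (h x)"
      using IH by auto
    then have "w = h (commutator G y x)" "commutator G y x \<in> gamma_values G X (Suc n)" using eq by auto
    then show "w \<in> h ` gamma_values G X (Suc n)" by blast
  qed
qed simp

lemma (in group) commutator_in_derived:
  assumes "subgroup V G" "a \<in> V" "b \<in> V"
  shows "commutator G a b \<in> derived G V"
proof -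
  have c: "a \<in> carrier G" "b \<in> carrier G" using assms subgroup.mem_carrier by metis+
  have "commutator G a b = inv a \<otimes> inv b \<otimes> inv (inv a) \<otimes> inv (inv b)"
    using c by (simp add: commutator_def)
  then show ?thesis
    using assms subgroup.m_inv_closed[OF assms(1)] unfolding derived_def by (intro generate.incl) blast
qed

text \<open>The exponent must not depend on \<open>G\<close> or \<open>X\<close>, since the
  inductive step replaces both by their images in a quotient.\<close>

definition gamma_exponent :: "'a itself \<Rightarrow> nat \<Rightarrow> nat \<Rightarrow> nat \<Rightarrow> nat \<Rightarrow> bool" where
  "gamma_exponent (_ :: 'a itself) k n m e \<longleftrightarrow>
     (\<forall>(G :: 'a monoid) X. group G \<and> (\<forall>i\<in>{1..Suc n}. power_rich G k (X i)) \<and>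
        finite (gamma_values G X n) \<and> card (gamma_values G X n) \<le> m \<longrightarrow>
        (\<forall>w\<in>gamma_values G X n. w [^]\<^bsub>G\<^esub> e = \<one>\<^bsub>G\<^esub>))"

lemma gamma_exponentD:
  fixes G :: "'a monoid"
  assumes "gamma_exponent TYPE('a) k n m e" "group G" "\<And>i. i \<in> {1..Suc n} \<Longrightarrow> power_rich G k (X i)"
    "finite (gamma_values G X n)" "card (gamma_values G X n) \<le> m" "w \<in> gamma_values G X n"
  shows "w [^]\<^bsub>G\<^esub> e = \<one>\<^bsub>G\<^esub>"
  using assms unfolding gamma_exponent_def by blast

text \<open>Two quotients are taken: \<open>H\<close> by the derived subgroup of \<open>V\<close>,
  where the locale applies, and then \<open>H'\<close> by \<open>torsion_centralizer\<close>, where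
  the shorter commutators have at most \<open>m^(m^m)\<close> values and the induction hypothesis
  applies. The last factor of the exponent accounts for the derived subgroup of
  \<open>V\<close>.\<close>

lemma gamma_values_exponent_Suc:
  fixes G :: "'a monoid"
  assumes k: "0 < k" and m: "0 < m" and "group G"
    and X: "\<And>i. i \<in> {1..Suc (Suc n)} \<Longrightarrow> power_rich G k (X i)"
    and fin: "finite (gamma_values G X (Suc n))" "card (gamma_values G X (Suc n)) \<le> m"
    and IH: "gamma_exponent TYPE('a) k n (m ^ (m ^ m)) N"
    and w: "w \<in> gamma_values G X (Suc n)"
  shows "w [^]\<^bsub>G\<^esub> (k * fact m * fact m * N * (k * fact m) * fact (derived_bound m)) = \<one>\<^bsub>G\<^esub>"
proof -
  interpret G: group G by fact
  define W Y V where "W = gamma_values G X (Suc n)" and "Y = gamma_values G X n" and "V = generate G W"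
  have Xc: "conj_invariant G (X i)" if "i \<in> {1..Suc (Suc n)}" for i
    using X[OF that] by (simp add: power_rich_def)
  have Y: "conj_invariant G Y" unfolding Y_def using Xc by (intro G.conj_invariant_gamma_values) auto
  have W: "conj_invariant G W" unfolding W_def using Xc by (intro G.conj_invariant_gamma_values) auto
  have Wc: "W \<subseteq> carrier G" using W by (simp add: conj_invariant_def)
  have V: "subgroup V G" unfolding V_def by (rule G.generate_is_subgroup[OF Wc])
  have "V \<lhd> G"
    unfolding V_def using G.conj_invariantD(3)[OF W] by (intro G.normal_generateI[OF Wc])
  then have D: "derived G V \<lhd> G" by (rule G.derived_is_normal)
  obtain H :: "'a monoid" and h where h: "group_hom G H h" "h ` carrier G = carrier H"
    "\<And>g. g \<in> carrier G \<Longrightarrow> h g = \<one>\<^bsub>H\<^esub> \<longleftrightarrow> g \<in> derived G V"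
    using G.quotient_on_representatives[OF D] by blast
  interpret h: group_hom G H h by (rule h(1))
  let ?Xh = "h ` X (Suc (Suc n))" and ?Yh = "h ` Y"
  let ?Wh = "{commutator H y x | y x. y \<in> ?Yh \<and> x \<in> ?Xh}"
  have "h ` Y = gamma_values H (\<lambda>i. h ` X i) n"
    unfolding Y_def using Xc by (intro h.gamma_values_image) auto
  moreover have "h ` W = gamma_values H (\<lambda>i. h ` X i) (Suc n)"
    unfolding W_def using Xc by (intro h.gamma_values_image) auto
  ultimately have Wh: "?Wh = h ` W" by simp
  interpret A: abelian_commutators H ?Xh ?Yh ?Wh "generate H ?Wh" k m
  proof (unfold_locales)
    show "conj_invariant H ?Yh" by (rule h.conj_invariant_image[OF Y h(2)])
    show "power_rich H k ?Xh" using X h(2) by (intro h.power_rich_image) auto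
    show "finite ?Wh" unfolding Wh W_def using fin(1) by simp
    show "card ?Wh \<le> m" unfolding Wh W_def using fin card_image_le[OF fin(1), of h] by simp
    show "u \<otimes>\<^bsub>H\<^esub> v = v \<otimes>\<^bsub>H\<^esub> u" if uv: "u \<in> ?Wh" "v \<in> ?Wh" for u v
    proof -
      obtain a b where ab: "a \<in> W" "b \<in> W" "u = h a" "v = h b" using uv unfolding Wh by blast
      then have c: "a \<in> carrier G" "b \<in> carrier G" using Wc by auto
      have "commutator G a b \<in> derived G V"
        using ab V unfolding V_def by (intro G.commutator_in_derived generate.incl)
      then have "commutator H u v = \<one>\<^bsub>H\<^esub>"
        using ab(3,4) c h(3)[of "commutator G a b"] by (simp add: h.hom_commutator)
      then show ?thesis using ab(3,4) c by (simp add: h.H.commutator_eq_one_iff)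
    qed
  qed (use k m in auto)
  obtain H' :: "'a monoid" and h' where h': "group_hom H H' h'" "h' ` carrier H = carrier H'"
    "\<And>g. g \<in> carrier H \<Longrightarrow> h' g = \<one>\<^bsub>H'\<^esub> \<longleftrightarrow> g \<in> A.torsion_centralizer"
    using h.H.quotient_on_representatives[OF A.normal_torsion_centralizer] by blast
  interpret h': group_hom H H' h' by (rule h'(1))
  have "gamma_values H' (\<lambda>i. h' ` h ` X i) n = h' ` gamma_values H (\<lambda>i. h ` X i) n"
    using Xc h(2) by (intro h'.gamma_values_image[symmetric] h.conj_invariant_image) auto
  then have Y': "gamma_values H' (\<lambda>i. h' ` h ` X i) n = h' ` ?Yh"
    using \<open>h ` Y = gamma_values H (\<lambda>i. h ` X i) n\<close> by simp
  have card_Y': "finite (h' ` ?Yh) \<and> card (h' ` ?Yh) \<le> m ^ (m ^ m)"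
    by (rule A.card_image_torsion_quotient[OF h'(1,3)])
  have X': "power_rich H' k (h' ` h ` X i)" if "i \<in> {1..Suc n}" for i
    using that X h(2) h'(2) by (intro h'.power_rich_image h.power_rich_image) auto
  have torsion: "y [^]\<^bsub>H\<^esub> N \<in> A.torsion_centralizer" if "y \<in> ?Yh" for y
  proof -
    have yc: "y \<in> carrier H" using A.Y_closed[OF that] .
    have "h' y [^]\<^bsub>H'\<^esub> N = \<one>\<^bsub>H'\<^esub>"
    proof (rule gamma_exponentD[OF IH h'.H.is_group X'])
      show "finite (gamma_values H' (\<lambda>i. h' ` h ` X i) n)"
        "card (gamma_values H' (\<lambda>i. h' ` h ` X i) n) \<le> m ^ (m ^ m)"
        using card_Y' unfolding Y' by simp_all
      show "h' y \<in> gamma_values H' (\<lambda>i. h' ` h ` X i) n" using that unfolding Y' by simp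
    qed
    then have "h' (y [^]\<^bsub>H\<^esub> N) = \<one>\<^bsub>H'\<^esub>" using yc by (simp add: h'.hom_nat_pow)
    then show ?thesis using h'(3)[of "y [^]\<^bsub>H\<^esub> N"] yc by simp
  qed
  obtain y x where yx: "y \<in> Y" "x \<in> X (Suc (Suc n))" "w = commutator G y x"
    using w by (auto simp: Y_def)
  have wc: "w \<in> carrier G" using w Wc by (auto simp: W_def)
  have "h w = commutator H (h y) (h x)"
    unfolding yx(3) using G.conj_invariantD(1)[OF Y yx(1)] G.conj_invariantD(1)[OF Xc yx(2)]
    by (intro h.hom_commutator) auto
  then have "h w [^]\<^bsub>H\<^esub> (A.q * fact m * N * A.q) = \<one>\<^bsub>H\<^esub>"
    using A.commutator_pow_exponent[of "h y" "h x" N] torsion yx by simp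
  then have "h (w [^]\<^bsub>G\<^esub> (A.q * fact m * N * A.q)) = \<one>\<^bsub>H\<^esub>"
    using wc by (simp add: h.hom_nat_pow)
  then have in_D: "w [^]\<^bsub>G\<^esub> (A.q * fact m * N * A.q) \<in> derived G V"
    using h(3) wc by blast
  define v where "v = w [^]\<^bsub>G\<^esub> (A.q * fact m * N * A.q)"
  have vc: "v \<in> carrier G" using wc by (simp add: v_def)
  have sub: "subgroup (derived G V) G" using D by (rule normal_imp_subgroup)
  have bound: "finite (derived G V) \<and> card (derived G V) \<le> derived_bound m"
    using G.derived_generate_finite_bound[of W m] W fin m by (simp add: V_def W_def del: gamma_values.simps)
  \<comment> \<open>The powers of \<open>v\<close> stay in the derived subgroup of \<open>V\<close>.
    For its order only the upper bound \<open>derived_bound m\<close> is at hand, hence the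
    factorial.\<close>
  have "v [^]\<^bsub>G\<^esub> i \<otimes>\<^bsub>G\<^esub> \<one>\<^bsub>G\<^esub> \<in> derived G V" for i :: nat
  proof (induction i)
    case (Suc i)
    then show ?case using in_D vc subgroup.m_closed[OF sub, of "v [^]\<^bsub>G\<^esub> i" v] by (simp add: v_def[symmetric])
  qed (use subgroup.one_closed[OF sub] in simp)
  then have "v [^]\<^bsub>G\<^esub> (fact (derived_bound m) :: nat) = \<one>\<^bsub>G\<^esub>"
    using bound vc by (intro G.pow_fact_eq_one[where c = "\<one>\<^bsub>G\<^esub>"]) auto
  then show ?thesis using wc by (simp add: v_def G.nat_pow_pow A.q_def)
qed

text \<open>For a single entry, \<open>(w^k)^i = (w^i)^k\<close> lies in \<open>X 1\<close>, so
  \<open>w^k\<close> has at most \<open>m\<close> powers. Positivity of \<open>e\<close> is what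
  \<open>dietzmann_finite_bound\<close> asks for.\<close>

lemma gamma_exponent_exists:
  assumes "0 < k"
  shows "\<exists>e>0. gamma_exponent TYPE('a) k n m e"
proof (induction n arbitrary: m)
  case 0
  show ?case
    unfolding gamma_exponent_def
  proof (intro exI[of _ "k * fact m"] conjI allI impI ballI; (elim conjE)?)
    fix G :: "'a monoid" and X w
    assume "group G" and X: "\<forall>i\<in>{1..Suc 0}. power_rich G k (X i)"
      and fin: "finite (gamma_values G X 0)" "card (gamma_values G X 0) \<le> m"
      and w: "w \<in> gamma_values G X 0"
    interpret group G by fact
    have X1: "power_rich G k (X 1)" using X by simp
    then have wc: "w \<in> carrier G" using w by (auto simp: power_rich_def conj_invariant_def)
    have "(w [^]\<^bsub>G\<^esub> k) [^]\<^bsub>G\<^esub> i \<otimes>\<^bsub>G\<^esub> \<one>\<^bsub>G\<^esub> \<in> X 1" for i :: nat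
    proof -
      have "(w [^]\<^bsub>G\<^esub> i) [^]\<^bsub>G\<^esub> k \<in> X 1" using X1 wc by (simp add: power_rich_def)
      then show ?thesis using wc by (simp add: nat_pow_pow mult.commute)
    qed
    then have "(w [^]\<^bsub>G\<^esub> k) [^]\<^bsub>G\<^esub> (fact m :: nat) = \<one>\<^bsub>G\<^esub>"
      using fin wc by (intro pow_fact_eq_one[where T = "X 1" and c = "\<one>\<^bsub>G\<^esub>"]) auto
    then show "w [^]\<^bsub>G\<^esub> (k * fact m) = \<one>\<^bsub>G\<^esub>" using wc by (simp add: nat_pow_pow)
  qed (use assms in simp)
next
  case (Suc n)
  \<comment> \<open>\<open>Suc m\<close> takes the place of \<open>m\<close>, because the inductive
    step wants a positive bound.\<close>
  obtain N where N: "0 < N" "gamma_exponent TYPE('a) k n (Suc m ^ (Suc m ^ Suc m)) N"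
    using Suc by blast
  define e where "e = k * fact (Suc m) * fact (Suc m) * N * (k * fact (Suc m)) * fact (derived_bound (Suc m))"
  have "gamma_exponent TYPE('a) k (Suc n) m e"
    unfolding gamma_exponent_def e_def
  proof (intro allI impI ballI, elim conjE)
    fix G :: "'a monoid" and X w
    assume "group G" "\<forall>i\<in>{1..Suc (Suc n)}. power_rich G k (X i)" "finite (gamma_values G X (Suc n))"
      "card (gamma_values G X (Suc n)) \<le> m" "w \<in> gamma_values G X (Suc n)"
    then show "w [^]\<^bsub>G\<^esub> (k * fact (Suc m) * fact (Suc m) * N * (k * fact (Suc m)) *
        fact (derived_bound (Suc m))) = \<one>\<^bsub>G\<^esub>"
      by (intro gamma_values_exponent_Suc[OF assms _ _ _ _ _ N(2)]) (blast | simp del: gamma_values.simps)+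
  qed
  moreover have "0 < e" using assms N(1) by (simp add: e_def)
  ultimately show ?case by blast
qed

lemma generate_gamma_values_bound:
  assumes "0 < k"
  shows "\<exists>f. \<forall>(G :: 'a monoid) X. group G \<longrightarrow> (\<forall>i\<in>{1..Suc n}. power_rich G k (X i)) \<longrightarrow>
    finite (gamma_values G X n) \<longrightarrow>
    finite (generate G (gamma_values G X n)) \<and>
    card (generate G (gamma_values G X n)) \<le> f (card (gamma_values G X n))"
proof -
  \<comment> \<open>An exponent is chosen for every cardinality before a group is given, so that the
    resulting bound is uniform.\<close>
  obtain e :: "nat \<Rightarrow> nat" where e: "\<And>m. 0 < e m" "\<And>m. gamma_exponent TYPE('a) k n m (e m)"
    using gamma_exponent_exists[OF assms, where ?'a = 'a and n = n] by metis
  show ?thesis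
  proof (intro exI allI impI)
    fix G :: "'a monoid" and X
    assume G: "group G" and X: "\<forall>i\<in>{1..Suc n}. power_rich G k (X i)"
      and fin: "finite (gamma_values G X n)"
    have "conj_invariant G (gamma_values G X n)"
      using X by (intro group.conj_invariant_gamma_values[OF G]) (auto simp: power_rich_def)
    moreover have "x [^]\<^bsub>G\<^esub> e (card (gamma_values G X n)) = \<one>\<^bsub>G\<^esub>" if "x \<in> gamma_values G X n" for x
      using X fin that by (intro gamma_exponentD[OF e(2) G]) auto
    ultimately show "finite (generate G (gamma_values G X n)) \<and> card (generate G (gamma_values G X n)) \<le>
        (\<lambda>m. \<Sum>i\<le>m * e m. m ^ i) (card (gamma_values G X n))"
      using e(1) fin
      by (intro group.dietzmann_finite_bound[OF G]) auto
  qed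
qed

section \<open>Evaluation of words\<close>

lemma free_group_simps [simp]:
  "w \<in> carrier \<F> \<longleftrightarrow> reduced w" "u \<otimes>\<^bsub>\<F>\<^esub> v = reduce (u @ v)" "\<one>\<^bsub>\<F>\<^esub> = []"
  by (simp_all add: free_group_def)

lemma reduced_Nil [simp]: "reduced []" and reduced_singleton [simp]: "reduced [a]"
  by (simp_all add: reduced_def)

lemma word_eval_simps [simp]:
  "word_eval G \<rho> [] = \<one>\<^bsub>G\<^esub>"
  "word_eval G \<rho> ((i, s) # w) = (if s then \<rho> i else inv\<^bsub>G\<^esub> \<rho> i) \<otimes>\<^bsub>G\<^esub> word_eval G \<rho> w"
  by (simp_all add: word_eval_def)

lemma free_group_inv:
  assumes "reduced w"
  shows "inv\<^bsub>\<F>\<^esub> w = reduce (inverse_word w)"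
proof -
  interpret group \<F> by (rule group_free_group)
  have "reduce (reduce (inverse_word w) @ w) = []"
    unfolding reduce_append_left using foldr_push_inverse_word[of "[]" w] assms
    by (simp add: reduce_append reduce_reduced) (metis reduce_def reduce_reduced reduced_Nil)
  then show ?thesis using assms by (intro inv_equality) (simp_all add: reduced_reduce)
qed

lemma (in group) word_eval_reduce:
  assumes "\<And>i. \<rho> i \<in> carrier G"
  shows "word_eval G \<rho> (reduce w) = word_eval G \<rho> w"
proof -
  have push: "word_eval G \<rho> (push a w) = word_eval G \<rho> (a # w)" for a w
  proof (cases w)
    case (Cons b v)
    have "word_eval G \<rho> v \<in> carrier G" using assms by (rule word_eval_closed)
    then show ?thesis using Cons assms by (cases a; cases b) (auto simp: cancels_def)
  qed simp
  show ?thesis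
  proof (induction w)
    case (Cons a w)
    then show ?case using push[of a "reduce w"] by (cases a) (simp add: reduce_def)
  qed (simp add: reduce_def)
qed

lemma (in group) group_hom_word_eval:
  assumes "\<And>i. \<rho> i \<in> carrier G"
  shows "group_hom \<F> G (word_eval G \<rho>)"
proof -
  have "word_eval G \<rho> \<in> hom \<F> G"
    by (rule homI) (simp_all add: word_eval_closed word_eval_reduce word_eval_append assms)
  then show ?thesis
    using is_group group_free_group by (simp add: group_hom_def group_hom_axioms_def)
qed

lemma word_eval_word_var:
  assumes "reduced w"
  shows "word_eval \<F> word_var w = w"
proof -
  have "word_eval \<F> word_var w = reduce w"
  proof (induction w)
    case (Cons a w)
    obtain i s where a: "a = (i, s)" by (cases a)
    have "(if s then word_var i else inv\<^bsub>\<F>\<^esub> word_var i) = [a]"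
      using a by (auto simp: free_group_inv inverse_word_def reduce_reduced)
    then show ?case
      using Cons a reduce_append_right[of "[a]" w] by simp
  qed (simp add: reduce_def)
  then show ?thesis using assms by (simp add: reduce_reduced)
qed

lemma word_eval_cong:
  "(\<And>i. i \<in> word_vars w \<Longrightarrow> \<rho> i = \<sigma> i) \<Longrightarrow> word_eval G \<rho> w = word_eval G \<sigma> w"
  by (induction w) (auto simp: word_vars_def)

lemma word_values_iff:
  "x \<in> word_values w G \<longleftrightarrow> (\<exists>\<rho>. (\<forall>i. \<rho> i \<in> carrier G) \<and> x = word_eval G \<rho> w)"
  by (auto simp: word_values_def image_subset_iff)

lemma (in group) conj_invariant_word_values: "conj_invariant G (word_values w G)"
  unfolding conj_invariant_def
proof (intro conjI ballI subsetI)
  fix s assume "s \<in> word_values w G"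
  then obtain \<rho> where \<rho>: "\<And>i. \<rho> i \<in> carrier G" "s = word_eval G \<rho> w"
    unfolding word_values_iff by auto
  then show "s \<in> carrier G" by (simp add: word_eval_closed)
  fix g assume g: "g \<in> carrier G"
  let ?c = "\<lambda>x. inv g \<otimes> x \<otimes> g"
  have "?c \<in> hom G G" using g by (intro homI) (simp_all add: m_assoc)
  then interpret c: group_hom G G ?c
    using is_group by (simp add: group_hom_def group_hom_axioms_def)
  have "inv g \<otimes> s \<otimes> g = word_eval G (?c \<circ> \<rho>) w"
    unfolding \<rho>(2) by (rule c.hom_word_eval) (rule \<rho>(1))
  moreover have "\<forall>i. (?c \<circ> \<rho>) i \<in> carrier G" using \<rho>(1) g by simp
  ultimately show "inv g \<otimes> s \<otimes> g \<in> word_values w G" unfolding word_values_iff by blast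
qed


section \<open>Exponent sums\<close>

definition exponent_sum :: "nat \<Rightarrow> word \<Rightarrow> int" where
  "exponent_sum i w = (\<Sum>(j, s)\<leftarrow>w. if j = i then if s then 1 else -1 else 0)"

lemma exponent_sum_simps [simp]:
  "exponent_sum i [] = 0"
  "exponent_sum i ((j, s) # w) = (if j = i then if s then 1 else -1 else 0) + exponent_sum i w"
  "exponent_sum i (u @ v) = exponent_sum i u + exponent_sum i v"
  by (simp_all add: exponent_sum_def)

lemma exponent_sum_reduce [simp]: "exponent_sum i (reduce w) = exponent_sum i w"
proof -
  have push: "exponent_sum i (push a w) = exponent_sum i (a # w)" for a w
    by (cases w; cases a; cases "hd w") (auto simp: cancels_def)
  show ?thesis
  proof (induction w)
    case (Cons a w)
    then show ?case using push[of a "reduce w"] by (cases a) (simp add: reduce_def)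
  qed (simp add: reduce_def)
qed

lemma exponent_sum_inverse_word [simp]: "exponent_sum i (inverse_word w) = - exponent_sum i w"
proof (induction w)
  case (Cons a w)
  have "inverse_word (a # w) = inverse_word w @ [(fst a, \<not> snd a)]"
    by (simp add: inverse_word_def case_prod_unfold)
  then show ?case using Cons by (cases a) simp
qed (simp add: inverse_word_def)

lemma exponent_sum_derived:
  assumes "w \<in> derived \<F> (carrier \<F>)"
  shows "exponent_sum i w = 0"
proof -
  interpret group \<F> by (rule group_free_group)
  let ?K = "{w \<in> carrier \<F>. exponent_sum i w = 0}"
  have "subgroup ?K \<F>"
    by (rule subgroupI) (auto simp: free_group_inv reduced_reduce intro: exI[of _ "[]"])
  moreover have "derived_set \<F> (carrier \<F>) \<subseteq> ?K"
    by (auto simp: free_group_inv reduced_reduce)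
  ultimately have "derived \<F> (carrier \<F>) \<subseteq> ?K"
    unfolding derived_def by (rule generate_subgroup_incl[rotated])
  then show ?thesis using assms by auto
qed

text \<open>The inverse of the first letter must occur later in the word. In an abelian group this
  pair cancels, and the remaining word is shorter by two letters with the same exponent
  sums.\<close>

lemma (in comm_group) word_eval_exponent_sum_zero:
  assumes "\<And>i. \<rho> i \<in> carrier G" "\<And>i. exponent_sum i w = 0"
  shows "word_eval G \<rho> w = \<one>"
  using assms(2)
proof (induction w rule: length_induct)
  case (1 w)
  show ?case
  proof (cases w)
    case (Cons a w')
    obtain i s where a: "a = (i, s)" by (cases a)
    have "(i, \<not> s) \<in> set w'"
    proof (rule ccontr)
      assume *: "(i, \<not> s) \<notin> set w'"
      \<comment> \<open>Otherwise all occurrences of the variable have the sign \<open>s\<close>,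
        and the first letter makes its exponent sum non-zero.\<close>
      have "(if s then 1 else -1) * exponent_sum i v \<ge> 0" if "(i, \<not> s) \<notin> set v" for v
        using that by (induction v) (auto split: if_splits)
      from this[OF *] show False
        using 1(2)[rule_format, of i] Cons a by (auto split: if_splits)
    qed
    then obtain u v where w': "w' = u @ (i, \<not> s) # v" by (meson split_list)
    let ?g = "if s then \<rho> i else inv \<rho> i" and ?u = "word_eval G \<rho> u" and ?v = "word_eval G \<rho> v"
    have "?u \<in> carrier G" "?v \<in> carrier G" using assms(1) by (auto intro: word_eval_closed)
    then have "word_eval G \<rho> w = ?u \<otimes> ?v"
      using Cons a w' assms(1)[of i] by (auto simp: word_eval_append assms(1) m_lcomm)
    also have "\<dots> = word_eval G \<rho> (u @ v)" by (simp add: word_eval_append assms(1))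
    also have "\<dots> = \<one>"
    proof -
      have "exponent_sum j (u @ v) = 0" for j
        using 1(2)[rule_format, of j] Cons a w' by (auto split: if_splits)
      moreover have "length (u @ v) < length w" using Cons w' by simp
      ultimately show ?thesis using 1(1) by blast
    qed
    finally show ?thesis .
  qed simp
qed

text \<open>Exponent sums vanish on the derived subgroup. Conversely, a word all of whose exponent
  sums are zero becomes trivial in the abelianization \<open>H\<close> of the free group.\<close>

lemma non_commutator_word_iff:
  "non_commutator_word w \<longleftrightarrow> reduced w \<and> (\<exists>i. exponent_sum i w \<noteq> 0)"
proof (intro iffI conjI)
  show "reduced w" if "non_commutator_word w" using that by (simp add: non_commutator_word_def)
  show "non_commutator_word w" if "reduced w \<and> (\<exists>i. exponent_sum i w \<noteq> 0)"
    using that exponent_sum_derived[of w] by (auto simp: non_commutator_word_def)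
next
  assume w: "non_commutator_word w"
  interpret F: group \<F> by (rule group_free_group)
  show "\<exists>i. exponent_sum i w \<noteq> 0"
  proof (rule ccontr)
    assume "\<not> (\<exists>i. exponent_sum i w \<noteq> 0)"
    then have zero: "exponent_sum i w = 0" for i by simp
    obtain H :: "word monoid" and h where h: "group_hom \<F> H h" "h ` carrier \<F> = carrier H"
      "\<And>g. g \<in> carrier \<F> \<Longrightarrow> h g = \<one>\<^bsub>H\<^esub> \<longleftrightarrow> g \<in> derived \<F> (carrier \<F>)"
      using F.quotient_on_representatives[OF F.derived_self_is_normal] by blast
    interpret h: group_hom \<F> H h by (rule h(1))
    have "x \<otimes>\<^bsub>H\<^esub> y = y \<otimes>\<^bsub>H\<^esub> x" if "x \<in> carrier H" "y \<in> carrier H" for x y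
    proof -
      obtain a b where ab: "a \<in> carrier \<F>" "b \<in> carrier \<F>" "x = h a" "y = h b"
        using \<open>x \<in> carrier H\<close> \<open>y \<in> carrier H\<close> unfolding h(2)[symmetric] by blast
      have "h (commutator \<F> a b) = \<one>\<^bsub>H\<^esub>"
        using F.commutator_in_derived[OF F.subgroup_self ab(1,2)] h(3) F.commutator_closed[OF ab(1,2)]
        by blast
      then have "commutator H x y = \<one>\<^bsub>H\<^esub>" using ab h.hom_commutator by simp
      then show ?thesis using that by (simp add: h.H.commutator_eq_one_iff)
    qed
    then interpret H: comm_group H by (intro h.H.group_comm_groupI)
    \<comment> \<open>As \<open>w\<close> is its own evaluation at the variables, \<open>h w\<close>
      is a value of \<open>w\<close> in \<open>H\<close>.\<close>
    have "h w = h (word_eval \<F> word_var w)"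
      using w by (simp add: word_eval_word_var non_commutator_word_def)
    also have "\<dots> = word_eval H (h \<circ> word_var) w" by (rule h.hom_word_eval) simp
    also have "\<dots> = \<one>\<^bsub>H\<^esub>"
      using zero by (intro H.word_eval_exponent_sum_zero) auto
    finally show False using w h(3)[of w] by (auto simp: non_commutator_word_def)
  qed
qed

lemma (in group) word_eval_single_variable:
  assumes "g \<in> carrier G"
  shows "word_eval G (\<lambda>j. if j = i then g else \<one>) w = g [^] exponent_sum i w"
proof (induction w)
  case (Cons a w)
  obtain j s where a: "a = (j, s)" by (cases a)
  have "g [^] (1 + exponent_sum i w) = g \<otimes> g [^] exponent_sum i w"
    "g [^] (-1 + exponent_sum i w) = inv g \<otimes> g [^] exponent_sum i w"
    using assms int_pow_mult[of g 1] int_pow_mult[of g "-1"] int_pow_neg[of g 1] by simp_all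
  then show ?case using Cons a assms by simp
qed simp

text \<open>With \<open>e\<close> the exponent sum, substituting \<open>g^(k div e)\<close> for the
  variable \<open>i\<close> and \<open>1\<close> for all others yields \<open>g^k\<close>. Asking
  for divisibility lets one \<open>k\<close> serve several words.\<close>

lemma (in group) power_rich_word_values:
  assumes "exponent_sum i w \<noteq> 0" "nat \<bar>exponent_sum i w\<bar> dvd k"
  shows "power_rich G k (word_values w G)"
  unfolding power_rich_def
proof (intro conjI ballI)
  fix g assume g: "g \<in> carrier G"
  let ?e = "exponent_sum i w"
  have "int k = ?e * (int k div ?e)"
    using assms(2) by (metis abs_dvd_iff abs_ge_zero dvd_mult_div_cancel int_dvd_int_iff int_nat_eq)
  then have "g [^] k = (g [^] (int k div ?e)) [^] ?e"
    using g by (metis int_pow_int int_pow_pow mult.commute)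
  also have "\<dots> = word_eval G (\<lambda>j. if j = i then g [^] (int k div ?e) else \<one>) w"
    using g by (simp add: word_eval_single_variable)
  also have "\<dots> \<in> word_values w G" using g unfolding word_values_iff
    by (intro exI[of _ "\<lambda>j. if j = i then g [^] (int k div ?e) else \<one>"]) simp
  finally show "g [^] k \<in> word_values w G" .
qed (rule conj_invariant_word_values)


section \<open>Lower central words in disjoint words\<close>

text \<open>Free reduction introduces no new variables.\<close>

lemma subgroup_words_in_vars: "subgroup {w. reduced w \<and> word_vars w \<subseteq> S} \<F>"
proof -
  interpret group \<F> by (rule group_free_group)
  have push: "word_vars (push a w) \<subseteq> insert (fst a) (word_vars w)" for a w
    by (cases w) (auto simp: word_vars_def)
  have reduce: "word_vars (reduce w) \<subseteq> word_vars w" for w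
  proof (induction w)
    case (Cons a w)
    have "word_vars (reduce (a # w)) \<subseteq> insert (fst a) (word_vars (reduce w))"
      using push[of a "reduce w"] by (simp add: reduce_def)
    also have "\<dots> \<subseteq> word_vars (a # w)" using Cons by (auto simp: word_vars_def)
    finally show ?case .
  qed (simp add: reduce_def)
  have append: "word_vars (u @ v) = word_vars u \<union> word_vars v" for u v
    by (auto simp: word_vars_def)
  have inverse: "word_vars (inverse_word w) = word_vars w" for w
    by (force simp: word_vars_def inverse_word_def)
  show ?thesis
  proof (rule subgroupI)
    fix u v assume "u \<in> {w. reduced w \<and> word_vars w \<subseteq> S}" "v \<in> {w. reduced w \<and> word_vars w \<subseteq> S}"
    then show "u \<otimes>\<^bsub>\<F>\<^esub> v \<in> {w. reduced w \<and> word_vars w \<subseteq> S}"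
      using reduce[of "u @ v"] by (auto simp: reduced_reduce append)
  next
    fix w assume "w \<in> {w. reduced w \<and> word_vars w \<subseteq> S}"
    then show "inv\<^bsub>\<F>\<^esub> w \<in> {w. reduced w \<and> word_vars w \<subseteq> S}"
      using reduce[of "inverse_word w"] by (auto simp: reduced_reduce free_group_inv inverse)
  qed (auto simp: word_vars_def intro: exI[of _ "[]"])
qed

lemma gamma_word_in_vars: "gamma_word n \<in> {w. reduced w \<and> word_vars w \<subseteq> {1..n}}"
proof (induction n rule: gamma_word.induct)
  case (3 n)
  interpret K: subgroup "{w. reduced w \<and> word_vars w \<subseteq> {1..Suc (Suc n)}}" \<F>
    by (rule subgroup_words_in_vars)
  have "gamma_word (Suc n) \<in> {w. reduced w \<and> word_vars w \<subseteq> {1..Suc (Suc n)}}" using 3 by auto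
  moreover have "word_var (Suc (Suc n)) \<in> {w. reduced w \<and> word_vars w \<subseteq> {1..Suc (Suc n)}}"
    by (auto simp: word_vars_def)
  ultimately show ?case
    unfolding gamma_word.simps commutator_def by (intro K.m_closed K.m_inv_closed)
qed (auto simp: word_vars_def)

lemma gamma_word_reduced: "reduced (gamma_word n)" and gamma_word_vars: "word_vars (gamma_word n) \<subseteq> {1..n}"
  using gamma_word_in_vars[of n] by auto

lemma (in group) word_eval_gamma_word:
  assumes "\<And>i. \<rho> i \<in> carrier G"
  shows "word_eval G \<rho> (gamma_word (Suc (Suc n))) =
    commutator G (word_eval G \<rho> (gamma_word (Suc n))) (\<rho> (Suc (Suc n)))"
proof -
  interpret h: group_hom \<F> G "word_eval G \<rho>" by (rule group_hom_word_eval) (rule assms)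
  show ?thesis
    using h.hom_commutator[of "gamma_word (Suc n)" "word_var (Suc (Suc n))"] gamma_word_reduced assms
    by simp
qed

lemma (in group) gamma_values_eq:
  assumes "\<And>i. i \<in> {1..Suc n} \<Longrightarrow> X i \<subseteq> carrier G"
  shows "gamma_values G X n =
    {word_eval G \<sigma> (gamma_word (Suc n)) | \<sigma>. (\<forall>i. \<sigma> i \<in> carrier G) \<and> (\<forall>i\<in>{1..Suc n}. \<sigma> i \<in> X i)}"
  using assms
proof (induction n)
  case 0
  show ?case
  proof (intro equalityI subsetI)
    fix x assume x: "x \<in> gamma_values G X 0"
    then have "x \<in> carrier G" using 0 by auto
    then show "x \<in> {word_eval G \<sigma> (gamma_word (Suc 0)) | \<sigma>.
        (\<forall>i. \<sigma> i \<in> carrier G) \<and> (\<forall>i\<in>{1..Suc 0}. \<sigma> i \<in> X i)}"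
      using x by (auto intro!: exI[of _ "\<lambda>_. x"])
  qed auto
next
  case (Suc n)
  have IH: "gamma_values G X n =
      {word_eval G \<sigma> (gamma_word (Suc n)) | \<sigma>. (\<forall>i. \<sigma> i \<in> carrier G) \<and> (\<forall>i\<in>{1..Suc n}. \<sigma> i \<in> X i)}"
    using Suc by simp
  show ?case
  proof (intro equalityI subsetI)
    fix w assume "w \<in> gamma_values G X (Suc n)"
    then obtain y x where yx: "y \<in> gamma_values G X n" "x \<in> X (Suc (Suc n))" "w = commutator G y x" by auto
    then obtain \<sigma> where \<sigma>: "\<And>i. \<sigma> i \<in> carrier G" "\<And>i. i \<in> {1..Suc n} \<Longrightarrow> \<sigma> i \<in> X i"
      "y = word_eval G \<sigma> (gamma_word (Suc n))"
      using IH by blast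
    \<comment> \<open>A new value for the last variable does not affect
      \<open>gamma_word (Suc n)\<close>, which involves only variables in
      \<open>1..Suc n\<close>.\<close>
    let ?\<tau> = "\<sigma>(Suc (Suc n) := x)"
    have x: "x \<in> carrier G" using Suc.prems[of "Suc (Suc n)"] yx(2) by auto
    have "y = word_eval G ?\<tau> (gamma_word (Suc n))"
      unfolding \<sigma>(3) using gamma_word_vars[of "Suc n"] by (intro word_eval_cong) auto
    then have "w = word_eval G ?\<tau> (gamma_word (Suc (Suc n)))"
      using \<sigma>(1) x yx(3) by (subst word_eval_gamma_word) auto
    moreover have "\<forall>i. ?\<tau> i \<in> carrier G" using \<sigma>(1) x by simp
    moreover have "\<forall>i\<in>{1..Suc (Suc n)}. ?\<tau> i \<in> X i" using \<sigma>(2) yx(2) by auto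
    ultimately show "w \<in> {word_eval G \<sigma> (gamma_word (Suc (Suc n))) | \<sigma>.
        (\<forall>i. \<sigma> i \<in> carrier G) \<and> (\<forall>i\<in>{1..Suc (Suc n)}. \<sigma> i \<in> X i)}"
      by blast
  next
    fix w assume "w \<in> {word_eval G \<sigma> (gamma_word (Suc (Suc n))) | \<sigma>.
        (\<forall>i. \<sigma> i \<in> carrier G) \<and> (\<forall>i\<in>{1..Suc (Suc n)}. \<sigma> i \<in> X i)}"
    then obtain \<sigma> where \<sigma>: "\<And>i. \<sigma> i \<in> carrier G" "\<forall>i\<in>{1..Suc (Suc n)}. \<sigma> i \<in> X i"
      "w = word_eval G \<sigma> (gamma_word (Suc (Suc n)))" by blast
    have "word_eval G \<sigma> (gamma_word (Suc n)) \<in> gamma_values G X n"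
      unfolding IH using \<sigma>(1,2) by auto
    moreover have "w = commutator G (word_eval G \<sigma> (gamma_word (Suc n))) (\<sigma> (Suc (Suc n)))"
      unfolding \<sigma>(3) by (rule word_eval_gamma_word) (rule \<sigma>(1))
    moreover have "\<sigma> (Suc (Suc n)) \<in> X (Suc (Suc n))" using \<sigma>(2) by simp
    ultimately show "w \<in> gamma_values G X (Suc n)" by auto
  qed
qed

text \<open>Disjointness gives the inclusion from right to left: assignments for the separate words
  \<open>u i\<close> can be glued into one, since no variable belongs to two of them.\<close>

lemma (in group) word_values_gamma_word:
  assumes u: "\<And>i. i \<in> {1..Suc n} \<Longrightarrow> reduced (u i)"
    and disj: "disjoint_family_on (\<lambda>i. word_vars (u i)) {1..Suc n}"
  shows "word_values (subst_word u (gamma_word (Suc n))) G =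
    gamma_values G (\<lambda>i. word_values (u i) G) n"
proof -
  \<comment> \<open>Outside \<open>1..Suc n\<close> nothing is known about \<open>u\<close>, whereas
    \<open>hom_word_eval\<close> wants every substituted word to be reduced. The empty word is the
    default.\<close>
  let ?v = "\<lambda>i. if i \<in> {1..Suc n} then u i else []"
  have subst: "subst_word u (gamma_word (Suc n)) = subst_word ?v (gamma_word (Suc n))"
    using gamma_word_vars[of "Suc n"] by (intro word_eval_cong) auto
  have eval: "word_eval G \<rho> (subst_word u (gamma_word (Suc n))) =
      word_eval G (\<lambda>i. word_eval G \<rho> (?v i)) (gamma_word (Suc n))" if "\<And>i. \<rho> i \<in> carrier G" for \<rho>
  proof -
    interpret h: group_hom \<F> G "word_eval G \<rho>" by (rule group_hom_word_eval) (rule that)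
    show ?thesis
      unfolding subst using u by (subst h.hom_word_eval) (auto simp: comp_def)
  qed
  have closed: "word_values (u i) G \<subseteq> carrier G" for i
    using conj_invariant_word_values by (simp add: conj_invariant_def)
  show ?thesis
    unfolding gamma_values_eq[where X = "\<lambda>i. word_values (u i) G", OF closed]
  proof (intro equalityI subsetI)
    fix w assume "w \<in> word_values (subst_word u (gamma_word (Suc n))) G"
    then obtain \<rho> where \<rho>: "\<And>i. \<rho> i \<in> carrier G" "w = word_eval G \<rho> (subst_word u (gamma_word (Suc n)))"
      unfolding word_values_iff by auto
    have "\<forall>i\<in>{1..Suc n}. word_eval G \<rho> (?v i) \<in> word_values (u i) G"
      using \<rho>(1) by (auto simp: word_values_iff)
    moreover have "\<forall>i. word_eval G \<rho> (?v i) \<in> carrier G"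
      using word_eval_closed \<rho>(1) by blast
    ultimately show "w \<in> {word_eval G \<sigma> (gamma_word (Suc n)) | \<sigma>.
        (\<forall>i. \<sigma> i \<in> carrier G) \<and> (\<forall>i\<in>{1..Suc n}. \<sigma> i \<in> word_values (u i) G)}"
      using \<rho>(2) eval[of \<rho>, OF \<rho>(1)] by blast
  next
    fix w assume "w \<in> {word_eval G \<sigma> (gamma_word (Suc n)) | \<sigma>.
        (\<forall>i. \<sigma> i \<in> carrier G) \<and> (\<forall>i\<in>{1..Suc n}. \<sigma> i \<in> word_values (u i) G)}"
    then obtain \<sigma> where \<sigma>: "\<And>i. \<sigma> i \<in> carrier G" "\<forall>i\<in>{1..Suc n}. \<sigma> i \<in> word_values (u i) G"
      "w = word_eval G \<sigma> (gamma_word (Suc n))" by blast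
    obtain R where R: "\<And>i. i \<in> {1..Suc n} \<Longrightarrow> (\<forall>j. R i j \<in> carrier G) \<and> \<sigma> i = word_eval G (R i) (u i)"
      using \<sigma>(2) unfolding word_values_iff by metis
    define P where "P j i \<longleftrightarrow> i \<in> {1..Suc n} \<and> j \<in> word_vars (u i)" for j i
    \<comment> \<open>At most one word \<open>u i\<close> involves the variable \<open>j\<close>,
      and its assignment \<open>R i\<close> supplies the value; all other variables get
      \<open>1\<close>.\<close>
    define \<rho> where "\<rho> j = (if \<exists>i. P j i then R (THE i. P j i) j else \<one>)" for j
    have "i' = i" if "P j i" "P j i'" for i i' j
      using that disj unfolding P_def disjoint_family_on_def by blast
    then have the: "(THE i. P j i) = i" if "P j i" for i j
      using that by (intro the_equality)
    have \<rho>: "\<rho> j \<in> carrier G" for j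
    proof (cases "\<exists>i. P j i")
      case True
      then obtain i where i: "P j i" by blast
      then have "\<rho> j = R i j" using the[OF i] by (auto simp: \<rho>_def)
      then show ?thesis using R[of i] i by (auto simp: P_def)
    qed (simp add: \<rho>_def)
    have "word_eval G \<rho> (?v i) = \<sigma> i" if i: "i \<in> {1..Suc n}" for i
    proof -
      have "\<rho> j = R i j" if "j \<in> word_vars (u i)" for j
      proof -
        have "P j i" using that i by (simp add: P_def)
        then show ?thesis using the by (auto simp: \<rho>_def)
      qed
      then show ?thesis using R[OF i] i by (simp cong: word_eval_cong)
    qed
    then have "w = word_eval G (\<lambda>i. word_eval G \<rho> (?v i)) (gamma_word (Suc n))"
      unfolding \<sigma>(3) using gamma_word_vars[of "Suc n"] by (intro word_eval_cong) auto
    then have "w = word_eval G \<rho> (subst_word u (gamma_word (Suc n)))" using eval[of \<rho>, OF \<rho>] by simp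
    then show "w \<in> word_values (subst_word u (gamma_word (Suc n))) G"
      using \<rho> unfolding word_values_iff by blast
  qed
qed

section \<open>From value sets to bounded conciseness\<close>

lemma boundedly_concise_gamma_word:
  assumes "1 \<le> r" and u: "\<forall>i\<in>{1..r}. non_commutator_word (u i)"
    and disj: "disjoint_family_on (\<lambda>i. word_vars (u i)) {1..r}"
  shows "boundedly_concise TYPE('a) (subst_word u (gamma_word r))"
proof -
  obtain n where r: "r = Suc n" using assms(1) by (cases r) auto
  have "\<forall>i\<in>{1..r}. \<exists>j. exponent_sum j (u i) \<noteq> 0" using u by (simp add: non_commutator_word_iff)
  then obtain v where v: "\<And>i. i \<in> {1..r} \<Longrightarrow> exponent_sum (v i) (u i) \<noteq> 0" by metis
  \<comment> \<open>A common multiple of the exponent sums, so that all value sets are power-rich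
    for the same \<open>k\<close>.\<close>
  define k where "k = (\<Prod>i\<in>{1..r}. nat \<bar>exponent_sum (v i) (u i)\<bar>)"
  have "0 < k" unfolding k_def using v by (intro prod_pos) auto
  have dvd: "nat \<bar>exponent_sum (v i) (u i)\<bar> dvd k" if "i \<in> {1..r}" for i
    unfolding k_def using that by (intro dvd_prodI) auto
  have red: "reduced (u i)" if "i \<in> {1..Suc n}" for i
    using u that r by (simp add: non_commutator_word_iff)
  \<comment> \<open>The bound is found for groups on \<open>nat\<close>;
    \<open>conciseness_bound_nat_imp\<close> carries it over to \<open>'a\<close>.\<close>
  obtain f where f: "\<And>(G :: nat monoid) X. group G \<Longrightarrow> (\<forall>i\<in>{1..Suc n}. power_rich G k (X i)) \<Longrightarrow>
      finite (gamma_values G X n) \<Longrightarrow> finite (generate G (gamma_values G X n)) \<and>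
      card (generate G (gamma_values G X n)) \<le> f (card (gamma_values G X n))"
    using generate_gamma_values_bound[OF \<open>0 < k\<close>, where ?'a = nat and n = n] by metis
  have "conciseness_bound TYPE(nat) (subst_word u (gamma_word r)) f"
    unfolding conciseness_bound_def verbal_subgroup_def
  proof (intro allI impI)
    fix G :: "nat monoid"
    assume G: "group G \<and> finite (word_values (subst_word u (gamma_word r)) G)"
    then interpret group G by simp
    have "word_values (subst_word u (gamma_word r)) G = gamma_values G (\<lambda>i. word_values (u i) G) n"
      unfolding r using red disj r by (intro word_values_gamma_word) auto
    moreover have "\<forall>i\<in>{1..Suc n}. power_rich G k (word_values (u i) G)"
      using v dvd r by (blast intro: power_rich_word_values)
    ultimately show "finite (generate G (word_values (subst_word u (gamma_word r)) G)) \<and>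
        card (generate G (word_values (subst_word u (gamma_word r)) G)) \<le>
        f (card (word_values (subst_word u (gamma_word r)) G))"
      using f G by simp
  qed
  then show ?thesis
    unfolding boundedly_concise_def using conciseness_bound_nat_imp by blast
qed

section \<open>Powers of variables\<close>

lemma non_commutator_word_var_pow:
  assumes "n \<noteq> (0 :: int)"
  shows "non_commutator_word (word_var i [^]\<^bsub>\<F>\<^esub> n)"
proof -
  interpret group \<F> by (rule group_free_group)
  have red: "reduced (word_var i [^]\<^bsub>\<F>\<^esub> m)" for m :: nat
    using nat_pow_closed[of "word_var i" m] by simp
  have "exponent_sum i (word_var i [^]\<^bsub>\<F>\<^esub> m) = int m" for m :: nat
    by (induction m) simp_all
  then have "exponent_sum i (word_var i [^]\<^bsub>\<F>\<^esub> n) = n"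
    by (cases n rule: int_cases2) (simp_all add: int_pow_int int_pow_neg_int free_group_inv red)
  moreover have "reduced (word_var i [^]\<^bsub>\<F>\<^esub> n)" using int_pow_closed[of "word_var i" n] by simp
  ultimately show ?thesis using assms unfolding non_commutator_word_iff by metis
qed

lemma word_vars_word_var_pow: "word_vars (word_var i [^]\<^bsub>\<F>\<^esub> (n :: int)) \<subseteq> {i}"
proof -
  interpret group \<F> by (rule group_free_group)
  show ?thesis
    using subgroup_int_pow_closed[OF subgroup_words_in_vars[of "{i}"], of "word_var i" n]
    by (simp add: word_vars_def)
qed

theorem corollary2p13:
  fixes r :: nat
  assumes "r \<ge> 1"
  shows "(\<forall>u :: nat \<Rightarrow> word.
            (\<forall>i\<in>{1..r}. non_commutator_word (u i)) \<and> disjoint_family_on (\<lambda>i. word_vars (u i)) {1..r} \<longrightarrow>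
            boundedly_concise TYPE('a) (subst_word u (gamma_word r))) \<and>
         (\<forall>n :: nat \<Rightarrow> int. (\<forall>i\<in>{1..r}. n i \<noteq> 0) \<longrightarrow>
            boundedly_concise TYPE('a) (subst_word (\<lambda>i. word_var i [^]\<^bsub>\<F>\<^esub> n i) (gamma_word r)))"
proof (intro conjI allI impI)
  fix u :: "nat \<Rightarrow> word"
  assume "(\<forall>i\<in>{1..r}. non_commutator_word (u i)) \<and> disjoint_family_on (\<lambda>i. word_vars (u i)) {1..r}"
  then show "boundedly_concise TYPE('a) (subst_word u (gamma_word r))"
    using boundedly_concise_gamma_word[OF assms] by blast
next
  fix n :: "nat \<Rightarrow> int"
  assume "\<forall>i\<in>{1..r}. n i \<noteq> 0"
  then have "\<forall>i\<in>{1..r}. non_commutator_word (word_var i [^]\<^bsub>\<F>\<^esub> n i)"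
    using non_commutator_word_var_pow by blast
  moreover have "disjoint_family_on (\<lambda>i. word_vars (word_var i [^]\<^bsub>\<F>\<^esub> n i)) {1..r}"
    unfolding disjoint_family_on_def using word_vars_word_var_pow by blast
  ultimately show "boundedly_concise TYPE('a) (subst_word (\<lambda>i. word_var i [^]\<^bsub>\<F>\<^esub> n i) (gamma_word r))"
    by (rule boundedly_concise_gamma_word[OF assms])
qed

end
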